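(* There exists a universal constant $C>0$ such that the following holds. Let $\mathcal{J}\subset\mathbb{N}$ be a finite set with $N=\#(\mathcal{J})$, let $\alpha>1$, let $s$ be an integer with $1\le s\le N$, and let $\delta,\gamma,\gamma_0$ be positive reals with $0<\delta<1$ and $0<\gamma+\gamma_0<1$. Put $s_{\alpha,\delta}=\dfrac{(1+\alpha)^2 s}{\delta^{3/2}}$ and assume that the positive integer $m$ satisfies $$ m \ge C (1+\alpha)^4 s^2 \max\Big\{ \delta^{-12}\gamma_0^{-1}\log^2(s_{\alpha,\delta})\log^2(2N),\ \ \delta^{-\frac{15}{2}}\log^{\frac32}(s_{\alpha,\delta})\log(2N),\ \ \delta^{-4}\log(s_{\alpha,\delta})\log\Big(\frac{\log(s_{\alpha,\delta})}{\gamma\delta}\Big)\Big\}. $$ Let $y_1,\dots,y_m$ be drawn independently from the uniform distribution on $[-1,1]$. Then, with probability exceeding $1-(\gamma+\gamma_0)$, the normalized sampling matrix $A=\big(L_j(y_i)/\sqrt{m}\big)_{1\le i\le m,\,j\in\mathcal{J}}\in\mathbb{R}^{m\times N}$ satisfies $$ \|Az\|_2^2>(1-\delta)\|z\|_2^2\qquad\text{for all } z\in C(s;\alpha)\setminus\{0\}. $$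
   Context: $\mathbb{N}=\{0,1,2,\dots\}$. For $j\in\mathbb{N}$, $L_j$ is the univariate Legendre polynomial of degree $j$ normalized to be orthonormal with respect to the uniform probability measure $dy/2$ on $[-1,1]$ (so $\|L_j\|_{L^\infty([-1,1])}=\sqrt{2j+1}$). Vectors $z\in\mathbb{R}^N$ are indexed by $\mathcal{J}$. For $S\subset\mathcal{J}$, $S^c=\mathcal{J}\setminus S$ and $z_S$ is the restriction of $z$ to $S$. For $S\subset\mathcal{J}$ with $\#(S)=s$ set $$C(S;\alpha)=\{z\in\mathbb{R}^N:\ \|z_{S^c}\|_1\le\alpha\sqrt{s}\,\|z_S\|_2\},\qquad C(s;\alpha)=\bigcup_{S\subset\mathcal{J},\ \#(S)=s}C(S;\alpha).$$ "Universal constant" means independent of all parameters ($m,N,s,\mathcal{J},\alpha,\delta,\gamma,\gamma_0$). *)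

theory Defs
  imports "HOL-Probability.Probability" "HOL-Computational_Algebra.Polynomial"
begin

(* Rodrigues' formula; this is the classical normalization, with value 1 at 1. *)
definition legendre_poly :: "nat \<Rightarrow> real poly" where
  "legendre_poly j = smult (1 / (2 ^ j * fact j)) ((pderiv ^^ j) ([:-1, 0, 1:] ^ j))"

definition legendre :: "nat \<Rightarrow> real \<Rightarrow> real" where
  "legendre j y = sqrt (2 * real j + 1) * poly (legendre_poly j) y"

(* The probability measure dy/2 on [-1,1]. *)
definition unif :: "real measure" where
  "unif = uniform_measure lborel {-1..1}"

definition sampling_matrix :: "nat \<Rightarrow> (nat \<Rightarrow> real) \<Rightarrow> nat \<Rightarrow> nat \<Rightarrow> real" where
  "sampling_matrix m y i j = legendre j (y i) / sqrt (real m)"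

(* Vectors indexed by J are the functions on nat that vanish outside J. *)
definition vecs :: "nat set \<Rightarrow> (nat \<Rightarrow> real) set" where
  "vecs J = {z. \<forall>j. j \<notin> J \<longrightarrow> z j = 0}"

(* A matrix with columns indexed by J, applied to a vector in vecs J. *)
definition mat_vec :: "nat set \<Rightarrow> (nat \<Rightarrow> nat \<Rightarrow> real) \<Rightarrow> (nat \<Rightarrow> real) \<Rightarrow> nat \<Rightarrow> real" where
  "mat_vec J A z i = (\<Sum>j\<in>J. A i j * z j)"

definition l1_cone_on :: "nat set \<Rightarrow> nat set \<Rightarrow> real \<Rightarrow> (nat \<Rightarrow> real) set" where
  "l1_cone_on J S \<alpha> =
     {z \<in> vecs J. (\<Sum>j\<in>J - S. \<bar>z j\<bar>) \<le> \<alpha> * sqrt (real (card S)) * L2_set z S}"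

definition l1_cone :: "nat set \<Rightarrow> nat \<Rightarrow> real \<Rightarrow> (nat \<Rightarrow> real) set" where
  "l1_cone J s \<alpha> = (\<Union>S\<in>{S. S \<subseteq> J \<and> card S = s}. l1_cone_on J S \<alpha>)"


lemma degree_legendre_poly: "degree (legendre_poly j) = j"
  by (simp add: legendre_poly_def degree_higher_pderiv degree_power_eq)

abbreviation (input) polint :: "real poly \<Rightarrow> real" where
  "polint p \<equiv> integral {-1..1} (poly p)"

lemma poly_integrable: "poly p integrable_on {-1..1::real}"
  by (intro integrable_continuous_real continuous_intros)

lemma polint_pderiv: "polint (pderiv p) = poly p 1 - poly p (-1)"
proof -
  have "(poly (pderiv p) has_integral poly p 1 - poly p (-1)) {-1..1}"
    by (rule fundamental_theorem_of_calculus)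
       (auto simp: has_real_derivative_iff_has_vector_derivative[symmetric]
          intro: DERIV_subset poly_DERIV)
  then show ?thesis by (rule integral_unique)
qed

lemma polint_add: "polint (p + q) = polint p + polint q"
  using integral_add[OF poly_integrable poly_integrable] by (simp add: poly_add[abs_def])

lemma polint_smult: "polint (smult c p) = c * polint p"
  by (simp add: poly_smult[abs_def])

lemma polint_parts:
  assumes "poly p 1 = 0" "poly p (-1) = 0"
  shows "polint (pderiv p * q) = - polint (p * pderiv q)"
proof -
  have "polint (pderiv p * q + p * pderiv q) = 0"
    using polint_pderiv[of "p * q"] assms by (simp add: pderiv_mult algebra_simps)
  then show ?thesis by (simp only: polint_add)
qed

abbreviation (input) sq_minus_one_pow :: "nat \<Rightarrow> real poly" where
  "sq_minus_one_pow n \<equiv> [:-1, 0, 1:] ^ n"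

lemma dvd_higher_pderiv:
  fixes p r :: "real poly"
  shows "r ^ (k + n) dvd p \<Longrightarrow> r ^ n dvd (pderiv ^^ k) p"
proof (induction k arbitrary: n)
  case (Suc k)
  then have "r ^ Suc n dvd (pderiv ^^ k) p"
    by (metis add_Suc add_Suc_right)
  then obtain q where "(pderiv ^^ k) p = r ^ Suc n * q" ..
  then have "(pderiv ^^ Suc k) p = r ^ n * (r * pderiv q + smult (of_nat (Suc n)) (pderiv r) * q)"
    by (simp add: pderiv_mult pderiv_power_Suc algebra_simps del: power_Suc) simp
  then show ?case by simp
qed simp

lemma polint_rodrigues:
  assumes "k \<le> n"
  shows "polint ((pderiv ^^ n) (sq_minus_one_pow n) * q)
       = (-1) ^ k * polint ((pderiv ^^ (n - k)) (sq_minus_one_pow n) * (pderiv ^^ k) q)"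
  using assms
proof (induction k)
  case (Suc k)
  define p where "p = (pderiv ^^ (n - Suc k)) (sq_minus_one_pow n)"
  have "[:-1, 0, 1:] ^ 1 dvd p"
    unfolding p_def using Suc.prems by (intro dvd_higher_pderiv le_imp_power_dvd) auto
  then obtain r where "p = [:-1, 0, 1:] * r" by (auto simp only: dvd_def power_one_right)
  then have z: "poly p 1 = 0" "poly p (-1) = 0" by simp_all
  have "(pderiv ^^ (n - k)) (sq_minus_one_pow n) = pderiv p"
    unfolding p_def using Suc.prems by (metis Suc_diff_Suc Suc_le_lessD comp_apply funpow.simps(2))
  with Suc polint_parts[OF z, of "(pderiv ^^ k) q"] show ?case
    by (simp add: p_def del: poly_mult)
qed simp

lemma higher_pderiv_top:
  fixes p :: "real poly"
  assumes "degree p \<le> n"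
  shows "(pderiv ^^ n) p = [: fact n * coeff p n :]"
proof (rule poly_eqI)
  fix i show "coeff ((pderiv ^^ n) p) i = coeff [: fact n * coeff p n :] i"
    using assms
    by (cases i) (auto simp: coeff_higher_pderiv coeff_eq_0 pochhammer_fact)
qed

lemma polint_W: "polint (sq_minus_one_pow n) = (-1) ^ n * 2 ^ (2 * n + 1) * (fact n)\<^sup>2 / fact (2 * n + 1)"
proof (induction n)
  case 0
  show ?case by simp
next
  case (Suc n)
  have eq: "pderiv ([:0, 1:] * sq_minus_one_pow (Suc n))
      = smult (2 * real n + 3) (sq_minus_one_pow (Suc n)) + smult (2 * real n + 2) (sq_minus_one_pow n)"
  proof -
    have "pderiv (sq_minus_one_pow (Suc n)) = smult (real (Suc n)) (sq_minus_one_pow n) * [:0, 2:]"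
      unfolding pderiv_power_Suc by (simp add: pderiv_pCons)
    then show ?thesis
      unfolding pderiv_mult by (intro poly_ext) (simp add: pderiv_pCons algebra_simps)
  qed
  have "(2 * real n + 3) * polint (sq_minus_one_pow (Suc n)) + (2 * real n + 2) * polint (sq_minus_one_pow n) = 0"
    using polint_pderiv[of "[:0, 1:] * sq_minus_one_pow (Suc n)"] unfolding eq
    by (simp only: polint_add polint_smult) simp
  then have "polint (sq_minus_one_pow (Suc n)) = - (2 * real n + 2) / (2 * real n + 3) * polint (sq_minus_one_pow n)"
    by (simp add: field_simps)
  also have "\<dots> = (-1) ^ Suc n * 2 ^ (2 * Suc n + 1) * (fact (Suc n))\<^sup>2 / fact (2 * Suc n + 1)"
  proof -
    have f: "fact (2 * Suc n + 1) = (2 * real n + 3) * (2 * real n + 2) * fact (2 * n + 1)"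
      by (simp add: algebra_simps)
    have g: "fact (Suc n) = (2 * real n + 2) / 2 * fact n" by (simp add: field_simps)
    have "- B / A * (e * P * X\<^sup>2 / F) = (- e) * (4 * P) * (B / 2 * X)\<^sup>2 / (A * B * F)"
      if "A \<noteq> 0" "B \<noteq> 0" "F \<noteq> 0" for A B e P X F :: real
      using that by (simp add: field_simps power2_eq_square)
    from this[of "2 * real n + 3" "2 * real n + 2" "fact (2 * n + 1)"]
    show ?thesis unfolding Suc.IH f g by simp
  qed
  finally show ?case .
qed

lemma polint_legendre_less:
  assumes "degree q < n"
  shows "polint (legendre_poly n * q) = 0"
proof -
  have "(pderiv ^^ n) q = 0"
    using assms higher_pderiv_top[of q n] by (simp add: coeff_eq_0)
  then show ?thesis
    using polint_rodrigues[of n n q]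
    by (simp add: legendre_poly_def polint_smult poly_0[abs_def])
qed

lemma polint_legendre_same: "polint (legendre_poly n * legendre_poly n) = 2 / (2 * real n + 1)"
proof -
  have "degree (sq_minus_one_pow n) = 2 * n" by (simp add: degree_power_eq)
  moreover have "lead_coeff (sq_minus_one_pow n) = 1" by (simp add: lead_coeff_power)
  ultimately have "(pderiv ^^ (n + n)) (sq_minus_one_pow n) = [:fact (2 * n):]"
    using higher_pderiv_top[of "sq_minus_one_pow n" "n + n"] by (simp add: mult_2)
  then have "polint ((pderiv ^^ n) (sq_minus_one_pow n) * (pderiv ^^ n) (sq_minus_one_pow n)) = (-1) ^ n * (fact (2 * n) * polint (sq_minus_one_pow n))"
    using polint_rodrigues[of n n "(pderiv ^^ n) (sq_minus_one_pow n)"]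
    by (simp add: funpow_add polint_smult)
  then have "polint (legendre_poly n * legendre_poly n)
      = 1 / (2 ^ n * fact n)\<^sup>2 * ((-1) ^ n * (fact (2 * n) * polint (sq_minus_one_pow n)))"
    by (simp add: legendre_poly_def polint_smult power2_eq_square)
  also have "\<dots> = 2 / (2 * real n + 1)"
  proof -
    have *: "1 / (P * X)\<^sup>2 * (e * (G * (e * (2 * P\<^sup>2) * X\<^sup>2 / (B * G)))) = 2 / B"
      if "P \<noteq> 0" "X \<noteq> 0" "G \<noteq> 0" "B \<noteq> 0" "e * e = 1" for P X G B e :: real
    proof -
      have "1 / (P * X)\<^sup>2 * (e * (G * (e * (2 * P\<^sup>2) * X\<^sup>2 / (B * G)))) = 2 * (e * e) / B"
        using that(1-4) by (simp add: field_simps power2_eq_square)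
      with that(5) show ?thesis by simp
    qed
    have "(2::real) ^ (2 * n + 1) = 2 * (2 ^ n)\<^sup>2"
      by (simp add: power_mult[symmetric] mult.commute)
    moreover have "fact (2 * n + 1) = (2 * real n + 1) * fact (2 * n)" by simp
    moreover have "(- 1) ^ n * (- 1) ^ n = (1::real)" by (simp flip: power_mult_distrib)
    ultimately show ?thesis
      unfolding polint_W using *[of "2 ^ n" "fact n" "fact (2 * n)" "2 * real n + 1" "(-1) ^ n"] by (simp add: add.commute)
  qed
  finally show ?thesis .
qed

lemma integral_unif_poly: "(\<integral>y. poly p y \<partial>unif) = polint p / 2"
proof -
  have 1: "set_integrable lborel {-1..1} (poly p)"
    by (intro borel_integrable_atLeastAtMost') (auto intro: continuous_intros)
  have [simp]: "emeasure lborel {-1..1::real} = 2" by simp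
  have "(\<integral>y. poly p y \<partial>unif) = (\<integral>y. (indicator {-1..1} y / 2) *\<^sub>R poly p y \<partial>lborel)"
  proof -
    have "unif = density lborel (\<lambda>y. ennreal (indicator {-1..1} y / 2))"
      unfolding unif_def uniform_measure_def
      by (rule density_cong) (auto simp: indicator_def divide_ennreal[symmetric] split: if_splits)
    moreover have "integral\<^sup>L (density lborel (\<lambda>y. ennreal (indicator {-1..1} y / 2))) (poly p)
        = (\<integral>y. (indicator {-1..1} y / 2) *\<^sub>R poly p y \<partial>lborel)"
      by (rule integral_density)
         (auto intro!: borel_measurable_continuous_onI continuous_intros)
    ultimately show ?thesis by simp
  qed
  also have "\<dots> = (LINT y:{-1..1}|lborel. poly p y) / 2"
    by (simp add: set_lebesgue_integral_def)
  also have "\<dots> = polint p / 2"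
    using set_borel_integral_eq_integral(2)[OF 1] by simp
  finally show ?thesis .
qed

theorem legendre_orthonormal:
  "(\<integral>y. legendre i y * legendre j y \<partial>unif) = (if i = j then 1 else 0)"
proof -
  have less: "polint (legendre_poly a * legendre_poly b) = 0" if "b < a" for a b
    using polint_legendre_less[of "legendre_poly b" a] that by (simp add: degree_legendre_poly)
  have "polint (legendre_poly i * legendre_poly j) = (if i = j then 2 / (2 * real i + 1) else 0)"
    using less[of i j] less[of j i] polint_legendre_same[of i]
    by (cases i j rule: linorder_cases) (simp_all add: mult.commute)
  moreover have "(\<integral>y. legendre i y * legendre j y \<partial>unif)
     = (\<integral>y. sqrt (2 * real i + 1) * sqrt (2 * real j + 1) * poly (legendre_poly i * legendre_poly j) y \<partial>unif)"
    by (simp add: legendre_def mult_ac)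
  ultimately show ?thesis
    by (simp only: integral_mult_right_zero integral_unif_poly) (simp add: divide_simps)
qed

end

theory Submission
  imports Defs
begin

text \<open>On the cone, \<open>\<parallel>z\<parallel>\<^sub>1\<^sup>2 \<le> K \<parallel>z\<parallel>\<^sub>2\<^sup>2\<close> with \<open>K = (1 + \<alpha>)\<^sup>2 s\<close>, so the claim follows once every entry of the
  Gram matrix of \<open>A\<close> is within \<open>\<tau> < \<delta> / K\<close> of the identity. This cannot be asked of \<open>A\<close> itself,
  because the products of two Legendre polynomials have no uniformly bounded second moment. But
  discarding the samples outside \<open>[-b, b]\<close> only decreases \<open>\<parallel>Az\<parallel>\<^sub>2\<^sup>2\<close>, so a lower bound may be proved for the
  truncated matrix. Bernstein's inequality \<open>L\<^sub>j(y)\<^sup>2 \<le> 2 / sqrt (1 - y\<^sup>2)\<close> shows that the truncated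
  products have bias \<open>O(sqrt (1 - b))\<close>, second moment \<open>O(log (1 / (1 - b)))\<close> and supremum
  \<open>O(1 / sqrt (1 - b))\<close>, uniformly in \<open>j\<close> and \<open>k\<close>. With \<open>sqrt (1 - b)\<close> of order \<open>\<delta> / K\<close>, a Bernstein-type
  tail bound for each entry and a union bound over the \<open>N\<^sup>2\<close> entries need only
  \<open>m\<close> of order \<open>K\<^sup>2 \<delta>\<^sup>-\<^sup>2 log (K/\<delta>) (log (2N) + log (1/\<gamma>\<^sub>0))\<close>, which the first term of the maximum dominates.\<close>

subsection \<open>Bernstein's inequality for Legendre polynomials\<close>

lemma poly_pderiv_times_sq_minus_one:
  "poly (pderiv ([:-1, 0, 1:] * q)) x = (x\<^sup>2 - 1) * poly (pderiv q) x + 2 * x * poly q (x :: real)"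
  by (simp only: pderiv_mult) (simp add: pderiv_pCons algebra_simps power2_eq_square)

lemma poly_pderiv_times_X:
  "poly (pderiv ([:0, 1:] * q)) x = x * poly (pderiv q) x + poly q (x :: real)"
  by (simp only: pderiv_mult) (simp add: pderiv_pCons algebra_simps)

text \<open>For \<open>k = 0\<close> this is the derivative of \<open>(x^2 - 1) W' = 2 n x W\<close>
  with \<open>W = (x^2 - 1)^n\<close>. Each induction step differentiates the identity once more,
  until \<open>k = n\<close> is Legendre's equation.\<close>

lemma sq_minus_one_pow_ode:
  fixes n k :: nat
  defines "D \<equiv> (\<lambda>k. (pderiv ^^ k) ([:-1, 0, 1:] ^ n :: real poly))"
  shows "[:-1, 0, 1:] * D (Suc (Suc k)) + smult (2 - 2 * real n + 2 * real k) ([:0, 1:] * D (Suc k))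
    + smult (real k * (real k + 1) - 2 * real n * (real k + 1)) (D k) = 0"
proof (induction k)
  case 0
  have "[:-1, 0, 1:] * D 1 = smult (2 * real n) ([:0, 1:] * D 0)"
  proof (cases n)
    case (Suc l)
    have "pderiv ([:-1, 0, 1:] ^ Suc l) = smult (real (Suc l)) ([:-1, 0, 1:] ^ l) * [:0, 2 :: real:]"
      unfolding pderiv_power_Suc by (simp add: pderiv_pCons)
    then show ?thesis
      unfolding D_def Suc by (intro poly_ext) (simp add: algebra_simps)
  qed (simp add: D_def)
  then have "poly (pderiv ([:-1, 0, 1:] * D 1)) x = poly (pderiv (smult (2 * real n) ([:0, 1:] * D 0))) x" for x
    by simp
  then have "(x\<^sup>2 - 1) * poly (D 2) x + 2 * x * poly (D 1) x
      = 2 * real n * (x * poly (D 1) x + poly (D 0) x)" for x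
    unfolding pderiv_smult poly_smult poly_pderiv_times_sq_minus_one poly_pderiv_times_X
    by (simp add: D_def numeral_2_eq_2)
  then show ?case
    by (intro poly_ext) (simp add: algebra_simps power2_eq_square numeral_2_eq_2)
next
  case (Suc k)
  have D: "pderiv (D j) = D (Suc j)" for j
    by (simp add: D_def)
  have "poly (pderiv ([:-1, 0, 1:] * D (Suc (Suc k)) + smult (2 - 2 * real n + 2 * real k) ([:0, 1:] * D (Suc k))
    + smult (real k * (real k + 1) - 2 * real n * (real k + 1)) (D k))) x = 0" for x
    unfolding Suc by simp
  then show ?case
    unfolding pderiv_add pderiv_smult poly_add poly_smult poly_pderiv_times_sq_minus_one poly_pderiv_times_X D
    by (intro poly_ext) (simp add: algebra_simps power2_eq_square)
qed

text \<open>This is \<open>k = n\<close> above, scaled by the Rodrigues factor: the middle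
  coefficient becomes 2 and the last one becomes \<open>- n (n + 1)\<close>.\<close>

lemma legendre_poly_ode:
  fixes n :: nat and x :: real
  defines "p \<equiv> legendre_poly n"
  shows "(1 - x\<^sup>2) * poly (pderiv (pderiv p)) x
       = 2 * x * poly (pderiv p) x - real n * (real n + 1) * poly p x"
proof -
  define c :: real where "c = 1 / (2 ^ n * fact n)"
  define D where "D = (\<lambda>k. (pderiv ^^ k) ([:-1, 0, 1:] ^ n :: real poly))"
  have "poly ([:-1, 0, 1:] * D (Suc (Suc n)) + smult (2 - 2 * real n + 2 * real n) ([:0, 1:] * D (Suc n))
    + smult (real n * (real n + 1) - 2 * real n * (real n + 1)) (D n)) x = 0"
    unfolding D_def sq_minus_one_pow_ode by simp
  then have *: "(1 - x\<^sup>2) * poly (D (Suc (Suc n))) x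
      = 2 * x * poly (D (Suc n)) x - real n * (real n + 1) * poly (D n) x"
    by (simp add: algebra_simps power2_eq_square)
  have "p = smult c (D n)" "pderiv p = smult c (D (Suc n))"
    "pderiv (pderiv p) = smult c (D (Suc (Suc n)))"
    by (simp_all add: p_def legendre_poly_def c_def D_def pderiv_smult)
  then show ?thesis
    using arg_cong[OF *, of "\<lambda>v. c * v"] by (simp add: algebra_simps)
qed

section \<open>Size of Legendre polynomials and their derivatives at the origin\<close>

lemma coeff_sq_minus_one_pow:
  "coeff ([:-1, 0, 1:] ^ n :: real poly) i = (if even i then (-1) ^ (n - i div 2) * real (n choose (i div 2)) else 0)"
proof -
  have "[:-1, 0, 1:] = monom 1 2 + [:-1 :: real:]"
    by (simp add: monom_altdef power2_eq_square)
  then have "[:-1, 0, 1:] ^ n = (\<Sum>k\<le>n. of_nat (n choose k) * monom 1 2 ^ k * [:-1 :: real:] ^ (n - k))"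
    by (simp only: binomial_ring)
  also have "\<dots> = (\<Sum>k\<le>n. monom ((-1) ^ (n - k) * real (n choose k)) (2 * k))"
    by (intro sum.cong refl)
       (simp add: monom_power poly_const_pow of_nat_poly smult_monom mult.commute)
  finally have "coeff ([:-1, 0, 1:] ^ n) i = (\<Sum>k\<le>n. if 2 * k = i then (-1) ^ (n - k) * real (n choose k) else 0)"
    by (simp add: coeff_sum)
  also have "\<dots> = (if even i then (-1) ^ (n - i div 2) * real (n choose (i div 2)) else 0)"
  proof (cases "even i")
    case True
    then have "2 * k = i \<longleftrightarrow> k = i div 2" for k by auto
    then show ?thesis using True by (simp add: sum.delta')
  qed (auto intro!: sum.neutral)
  finally show ?thesis .
qed

text \<open>The left side equals 1 at \<open>k = 0\<close> and decreases in \<open>k\<close>,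
  because \<open>(2 k + 1) (2 k + 3) \<le> (2 k + 2)^2\<close>. This is a Wallis-type bound.\<close>

lemma central_binomial_sq_le: "(real (2 * k choose k) / 4 ^ k)\<^sup>2 * (2 * real k + 1) \<le> 1"
proof (induction k)
  case (Suc k)
  have "real (Suc k) * real (2 * Suc k choose Suc k) = 2 * (2 * real k + 1) * real (2 * k choose k)"
  proof -
    have "Suc k * (2 * Suc k choose Suc k) = 2 * (Suc k * (Suc (2 * k) choose k))"
      using Suc_times_binomial[of k "Suc (2 * k)"] by (simp add: algebra_simps del: binomial_Suc_Suc)
    also have "(Suc (2 * k) choose k) = (Suc (2 * k) choose Suc k)"
      using binomial_symmetric[of k "Suc (2 * k)"] by (simp del: binomial_Suc_Suc)
    also have "Suc k * (Suc (2 * k) choose Suc k) = Suc (2 * k) * (2 * k choose k)"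
      by (rule Suc_times_binomial)
    finally have "Suc k * (2 * Suc k choose Suc k) = 2 * (Suc (2 * k) * (2 * k choose k))" .
    then have "real (Suc k * (2 * Suc k choose Suc k)) = real (2 * (Suc (2 * k) * (2 * k choose k)))"
      by (rule arg_cong)
    then show ?thesis by (simp add: algebra_simps del: binomial_Suc_Suc)
  qed
  then have "(real k + 1) * real (2 * Suc k choose Suc k) = 2 * (2 * real k + 1) * real (2 * k choose k)"
    by (simp only: of_nat_Suc add.commute)
  then have "real (2 * Suc k choose Suc k) = 2 * (2 * real k + 1) * real (2 * k choose k) / (real k + 1)"
    by (subst eq_divide_eq) (simp add: mult.commute del: binomial_Suc_Suc)
  then have eq: "real (2 * Suc k choose Suc k) / 4 ^ Suc k
      = (2 * real k + 1) / (2 * real k + 2) * (real (2 * k choose k) / 4 ^ k)"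
    by (simp only: power_Suc) (simp add: divide_simps algebra_simps)
  have le: "((2 * real k + 1) / (2 * real k + 2))\<^sup>2 * (2 * real (Suc k) + 1) \<le> 2 * real k + 1"
  proof -
    have "(2 * real k + 1)\<^sup>2 * (2 * real k + 3) \<le> (2 * real k + 1) * (2 * real k + 2)\<^sup>2"
      by (simp add: power2_eq_square algebra_simps)
    then show ?thesis by (simp add: power_divide divide_simps algebra_simps)
  qed
  have "(real (2 * Suc k choose Suc k) / 4 ^ Suc k)\<^sup>2 * (2 * real (Suc k) + 1)
      \<le> (real (2 * k choose k) / 4 ^ k)\<^sup>2 * (2 * real k + 1)"
    unfolding eq power_mult_distrib
    using mult_left_mono[OF le zero_le_power2, of "real (2 * k choose k) / 4 ^ k"]
    by (simp only: mult_ac)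
  with Suc.IH show ?case by linarith
qed simp

text \<open>The left side is \<open>2 n + 1\<close> times the Sonin function \<open>S\<close> of the
  next lemma at 0. By parity only one of the two summands is nonzero, and in either case it comes
  down to a central binomial coefficient.\<close>

lemma legendre_poly_at_0:
  fixes n :: nat
  defines "p \<equiv> legendre_poly n"
  shows "(2 * real n + 1) * ((poly p 0)\<^sup>2 + (poly (pderiv p) 0)\<^sup>2 / ((real n + 1/2)\<^sup>2 + 1/4)) \<le> 2"
proof -
  \<comment> \<open>Under Rodrigues' formula the value and the derivative at 0 are, up to explicit
    factors, the coefficients of \<open>(x^2 - 1)^n\<close> in degrees \<open>n\<close> and
    \<open>n + 1\<close>.\<close>
  have p: "poly p 0 = coeff ([:-1, 0, 1:] ^ n) n / 2 ^ n"
    by (simp add: p_def legendre_poly_def poly_0_coeff_0 coeff_higher_pderiv flip: pochhammer_fact)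
  have "fact (Suc n) = (pochhammer 2 n :: real)"
    using pochhammer_rec[of "1::real" n] by (simp add: pochhammer_fact)
  then have p': "poly (pderiv p) 0 = (real n + 1) * coeff ([:-1, 0, 1:] ^ n) (Suc n) / 2 ^ n"
    by (simp add: p_def legendre_poly_def poly_0_coeff_0 coeff_pderiv coeff_higher_pderiv field_simps)
       (simp add: algebra_simps flip: \<open>fact (Suc n) = pochhammer 2 n\<close>)
  show ?thesis
  proof (cases "even n")
    case True
    then obtain k where k: "n = 2 * k" by auto
    define c where "c = real (2 * k choose k) / 4 ^ k"
    have "\<bar>poly p 0\<bar> = c"
      unfolding p coeff_sq_minus_one_pow k c_def by (simp add: abs_mult power_mult)
    then have "(poly p 0)\<^sup>2 = c\<^sup>2"
      by (metis power2_abs)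
    moreover have "poly (pderiv p) 0 = 0"
      unfolding p' coeff_sq_minus_one_pow k by simp
    moreover have "(2 * real n + 1) * c\<^sup>2 \<le> 2 * (c\<^sup>2 * (2 * real k + 1))"
      by (simp add: k algebra_simps)
    ultimately show ?thesis
      using central_binomial_sq_le[of k, folded c_def] by simp
  next
    case False
    then obtain k where k: "n = 2 * k + 1" using oddE by blast
    define c where "c = real (2 * k choose k) / 4 ^ k"
    have "poly p 0 = 0"
      unfolding p coeff_sq_minus_one_pow k by simp
    have "Suc k * (Suc (2 * k) choose Suc k) = Suc (2 * k) * (2 * k choose k)"
      by (rule Suc_times_binomial)
    then have "real (Suc k * (Suc (2 * k) choose Suc k)) = real (Suc (2 * k) * (2 * k choose k))"
      by (rule arg_cong)
    then have b: "real (Suc (2 * k) choose Suc k) = (2 * real k + 1) / (real k + 1) * real (2 * k choose k)"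
      by (simp add: field_simps del: binomial_Suc_Suc)
    have "\<bar>poly (pderiv p) 0\<bar> = (2 * real k + 2) * real (Suc (2 * k) choose Suc k) / 2 ^ (2 * k + 1)"
      unfolding p' coeff_sq_minus_one_pow k by (simp add: abs_mult del: binomial_Suc_Suc)
    also have "\<dots> = (2 * real k + 1) * c"
    proof -
      have "(2::real) ^ (2 * k + 1) = 2 * 4 ^ k" by (simp add: power_mult)
      then show ?thesis unfolding b c_def by (simp add: divide_simps)
    qed
    finally have "(poly (pderiv p) 0)\<^sup>2 = ((2 * real k + 1) * c)\<^sup>2"
      by (metis power2_abs)
    then have sq: "(poly (pderiv p) 0)\<^sup>2 \<le> 2 * real k + 1"
      using central_binomial_sq_le[of k, folded c_def]
        mult_left_mono[of "c\<^sup>2 * (2 * real k + 1)" 1 "2 * real k + 1"]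
      by (simp add: power_mult_distrib power2_eq_square mult_ac)
    have "(2 * real n + 1) * (2 * real k + 1) \<le> 2 * ((real n + 1/2)\<^sup>2 + 1/4)"
      by (simp add: k power2_eq_square algebra_simps)
    then have "(2 * real n + 1) * (poly (pderiv p) 0)\<^sup>2 \<le> 2 * ((real n + 1/2)\<^sup>2 + 1/4)"
      using mult_left_mono[OF sq, of "2 * real n + 1"] by linarith
    moreover have "(real n + 1/2)\<^sup>2 + 1/4 > 0"
      by (intro add_nonneg_pos) auto
    ultimately show ?thesis
      using \<open>poly p 0 = 0\<close> by (simp add: pos_divide_le_eq)
  qed
qed

text \<open>Sonin's method: in the variable \<open>x = cos \<theta>\<close> the function \<open>u = sqrt (sin \<theta>) * p (cos \<theta>)\<close> satisfies
  \<open>u'' + \<phi> u = 0\<close> with \<open>\<phi> = (n + 1/2)\<^sup>2 + 1 / (4 sin\<^sup>2 \<theta>)\<close>, and \<open>S\<close> below is \<open>u\<^sup>2 + u'\<^sup>2 / \<phi>\<close>, which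
  attains its maximum at \<open>\<theta> = \<pi>/2\<close>.\<close>

lemma legendre_bernstein:
  assumes "\<bar>x\<bar> < 1"
  shows "(legendre n x)\<^sup>2 * sqrt (1 - x\<^sup>2) \<le> 2"
proof -
  define p where "p = legendre_poly n"
  define a where "a = (real n + 1/2)\<^sup>2"
  \<comment> \<open>In terms of \<theta>, \<open>r = - sqrt (sin \<theta>) * u'\<close> and
    \<open>q = sin\<^sup>2 \<theta> * \<phi>\<close>, so the second summand of \<open>S\<close> is
    \<open>u'\<^sup>2 / \<phi>\<close>.\<close>
  define r where "r = (\<lambda>x. (1 - x\<^sup>2) * poly (pderiv p) x - x * poly p x / 2)"
  define q where "q = (\<lambda>x::real. a * (1 - x\<^sup>2) + 1/4)"
  define S where "S = (\<lambda>x. sqrt (1 - x\<^sup>2) * ((poly p x)\<^sup>2 + (r x)\<^sup>2 / q x))"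
  have a0: "a \<ge> 0" by (simp add: a_def)
  \<comment> \<open>Sonin's identity: since \<open>u'' = - \<phi> u\<close>, the \<theta>-derivative
    of \<open>u\<^sup>2 + u'\<^sup>2 / \<phi>\<close> is
    \<open>- u'\<^sup>2 \<phi>' / \<phi>\<^sup>2\<close>. In the variable \<open>x\<close> its sign
    is that of \<open>- x\<close>, which puts the maximum of \<open>S\<close> at 0.\<close>
  have S': "(S has_real_derivative - (x / 2) * ((r x)\<^sup>2 / (sqrt (1 - x\<^sup>2) * (q x)\<^sup>2))) (at x)"
    if "\<bar>x\<bar> < 1" for x
  proof -
    define t where "t = 1 - x\<^sup>2"
    have t: "t > 0" using that by (simp add: t_def abs_square_less_1)
    have qx: "q x > 0" unfolding q_def using t a0 by (simp add: t_def add_nonneg_pos)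
    define P P' P'' where "P = poly p x" and "P' = poly (pderiv p) x" and "P'' = poly (pderiv (pderiv p)) x"
    have ode: "t * P'' = 2 * x * P' - (a - 1/4) * P"
      using legendre_poly_ode[of x n, folded p_def]
      by (simp add: t_def P_def P'_def P''_def a_def power2_eq_square algebra_simps)
    have p1: "(poly p has_real_derivative P') (at x)" and p2: "(poly (pderiv p) has_real_derivative P'') (at x)"
      by (simp_all add: P'_def P''_def poly_DERIV)
    define R where "R = r x"
    have R: "t * P' = R + x * P / 2" by (simp add: R_def r_def t_def P_def P'_def)
    have r': "(r has_real_derivative (- 2 * x * P' + t * P'' - P / 2 - x * P' / 2)) (at x)"
      unfolding r_def
      by (auto intro!: derivative_eq_intros p1 p2 simp: P_def P'_def P''_def t_def power2_eq_square field_simps)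
    define R' where "R' = - (a + 1/4) * P - x * P' / 2"
    have r'': "(r has_real_derivative R') (at x)"
      using r' unfolding ode R'_def by (simp add: algebra_simps)
    have sqt: "((\<lambda>x. sqrt (1 - x\<^sup>2)) has_real_derivative - x / sqrt t) (at x)"
      using t unfolding t_def by (auto intro!: derivative_eq_intros simp: field_simps)
    have q': "(q has_real_derivative - 2 * a * x) (at x)"
      unfolding q_def by (auto intro!: derivative_eq_intros)
    define Q where "Q = q x"
    have Q: "Q = a * t + 1/4" by (simp add: Q_def q_def t_def)
    have "(S has_real_derivative (- x / sqrt t * (P\<^sup>2 + R\<^sup>2 / Q)
        + (2 * P * P' + (2 * R * R' * Q - R\<^sup>2 * (- 2 * a * x)) / (Q * Q)) * sqrt t)) (at x)"
      unfolding S_def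
      by (rule DERIV_cong[OF DERIV_mult'[OF sqt DERIV_add[OF DERIV_power[OF p1, of 2]
            DERIV_divide[OF DERIV_power[OF r'', of 2] q']]]])
         (use qx in \<open>simp_all add: P_def R_def Q_def t_def algebra_simps\<close>)
    moreover have "- x / sqrt t * (P\<^sup>2 + R\<^sup>2 / Q)
        + (2 * P * P' + (2 * R * R' * Q - R\<^sup>2 * (- 2 * a * x)) / (Q * Q)) * sqrt t
      = - (x / 2) * R\<^sup>2 / (sqrt t * Q\<^sup>2)"
    proof -
      have st: "sqrt t * sqrt t = t" "sqrt t > 0" using t by simp_all
      have Q0: "Q > 0" using qx by (simp add: Q_def)
      \<comment> \<open>This is \<open>u'' + \<phi> u = 0\<close> expressed through
        \<open>R\<close>. With it the terms in \<open>P\<^sup>2\<close> and \<open>P * R\<close>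
        cancel below, leaving a multiple of \<open>R\<^sup>2\<close>.\<close>
      have tR': "t * R' = - Q * P - x * R / 2"
      proof -
        have "t * R' = - (a + 1/4) * P * t - x * (t * P') / 2" by (simp add: R'_def algebra_simps)
        also have "\<dots> = - Q * P - x * R / 2"
          unfolding R Q by (simp add: t_def power2_eq_square field_simps)
        finally show ?thesis .
      qed
      have "(- x / sqrt t * (P\<^sup>2 + R\<^sup>2 / Q)
        + (2 * P * P' + (2 * R * R' * Q - R\<^sup>2 * (- 2 * a * x)) / (Q * Q)) * sqrt t) * (sqrt t * Q\<^sup>2)
        = - x * (P\<^sup>2 * Q\<^sup>2 + R\<^sup>2 * Q) + (2 * P * P' * Q\<^sup>2 + 2 * R * R' * Q + 2 * a * x * R\<^sup>2) * (sqrt t * sqrt t)"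
      proof -
        have "(- x / h * (A + B / Q) + (c + D / (Q * Q)) * h) * (h * Q\<^sup>2)
            = - x * (A * Q\<^sup>2 + B * Q) + (c * Q\<^sup>2 + D) * (h * h)" if "h > 0" for h A B c D :: real
          using Q0 that by (simp add: field_simps power2_eq_square)
        from this[OF st(2), of "P\<^sup>2" "R\<^sup>2" "2 * P * P'" "2 * R * R' * Q - R\<^sup>2 * (- 2 * a * x)"]
        show ?thesis by (simp add: algebra_simps)
      qed
      also have "\<dots> = - x * (P\<^sup>2 * Q\<^sup>2 + R\<^sup>2 * Q) + 2 * P * (t * P') * Q\<^sup>2 + 2 * R * (t * R') * Q + 2 * (a * t) * x * R\<^sup>2"
        unfolding st by (simp add: algebra_simps)
      also have "\<dots> = - (x / 2) * R\<^sup>2"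
      proof -
        have at: "a * t = Q - 1/4" by (simp add: Q)
        show ?thesis unfolding R tR' at by (simp add: power2_eq_square field_simps)
      qed
      finally show ?thesis using Q0 st(2) by (simp add: field_simps)
    qed
    ultimately show ?thesis by (simp add: R_def Q_def t_def)
  qed
  have sgn: "(r y)\<^sup>2 / (sqrt (1 - y\<^sup>2) * (q y)\<^sup>2) \<ge> 0" if "\<bar>y\<bar> < 1" for y
    using that by (simp add: abs_square_le_1)
  have "S x \<le> S 0"
  proof (cases "x \<ge> 0")
    case True
    show ?thesis
    proof (rule DERIV_nonpos_imp_nonincreasing[OF True])
      fix y assume y: "0 \<le> y" "y \<le> x"
      then have *: "\<bar>y\<bar> < 1" using assms by simp
      show "\<exists>d. (S has_real_derivative d) (at y) \<and> d \<le> 0"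
        using S'[OF *] mult_nonpos_nonneg[OF _ sgn[OF *], of "- (y / 2)"] y by auto
    qed
  next
    case False
    then have "x \<le> 0" by simp
    then show ?thesis
    proof (rule DERIV_nonneg_imp_nondecreasing)
      fix y assume y: "x \<le> y" "y \<le> 0"
      then have *: "\<bar>y\<bar> < 1" using assms by simp
      show "\<exists>d. (S has_real_derivative d) (at y) \<and> d \<ge> 0"
        using S'[OF *] mult_nonneg_nonneg[OF _ sgn[OF *], of "- (y / 2)"] y by auto
    qed
  qed
  moreover have "sqrt (1 - x\<^sup>2) * (poly p x)\<^sup>2 \<le> S x"
    unfolding S_def
  proof (rule mult_left_mono)
    have "x\<^sup>2 \<le> 1" using assms by (simp add: abs_square_le_1)
    then have "q x \<ge> 0" unfolding q_def using a0 by simp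
    then show "(poly p x)\<^sup>2 \<le> (poly p x)\<^sup>2 + (r x)\<^sup>2 / q x" by simp
    show "sqrt (1 - x\<^sup>2) \<ge> 0" using \<open>x\<^sup>2 \<le> 1\<close> by simp
  qed
  ultimately have "sqrt (1 - x\<^sup>2) * (poly p x)\<^sup>2 \<le> S 0" by linarith
  then have "(2 * real n + 1) * (sqrt (1 - x\<^sup>2) * (poly p x)\<^sup>2) \<le> (2 * real n + 1) * S 0"
    by (rule mult_left_mono) simp
  also have "S 0 = (poly p 0)\<^sup>2 + (poly (pderiv p) 0)\<^sup>2 / ((real n + 1/2)\<^sup>2 + 1/4)"
    by (simp add: S_def q_def r_def a_def)
  also have "(2 * real n + 1) * \<dots> \<le> 2"
    unfolding p_def by (rule legendre_poly_at_0)
  finally show ?thesis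
    by (simp only: legendre_def p_def power_mult_distrib real_sqrt_pow2 mult_ac)
qed

subsection \<open>Moments of truncated products\<close>

lemma prob_space_unif: "prob_space unif"
  unfolding unif_def by (rule prob_space_uniform_measure) simp_all

lemma sets_unif [simp, measurable_cong]: "sets unif = sets borel"
  by (simp add: unif_def)

lemma space_unif [simp]: "space unif = UNIV"
  by (simp add: unif_def)

lemma legendre_measurable [measurable]: "legendre j \<in> borel_measurable borel"
  unfolding legendre_def by (intro borel_measurable_continuous_onI continuous_intros)

lemma integral_unif_truncated_poly:
  assumes "0 \<le> b" "b \<le> 1"
  shows "(\<integral>y. indicator {-b..b} y * poly p y \<partial>unif) = integral {-b..b} (poly p) / 2"
proof -
  have 1: "set_integrable lborel {-b..b} (poly p)"
    by (intro borel_integrable_atLeastAtMost') (auto intro: continuous_intros)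
  have [measurable]: "poly p \<in> borel_measurable borel"
    by (intro borel_measurable_continuous_onI continuous_intros)
  have "unif = density lborel (\<lambda>y. ennreal (indicator {-1..1} y / 2))"
    unfolding unif_def uniform_measure_def
    by (rule density_cong) (auto simp: indicator_def divide_ennreal[symmetric] split: if_splits)
  moreover have "(\<integral>y. indicator {-b..b} y * poly p y \<partial>density lborel (\<lambda>y. ennreal (indicator {-1..1} y / 2)))
      = (\<integral>y. (indicator {-1..1} y / 2) *\<^sub>R (indicator {-b..b} y * poly p y) \<partial>lborel)"
    by (rule integral_density) auto
  ultimately have "(\<integral>y. indicator {-b..b} y * poly p y \<partial>unif)
      = (\<integral>y. (indicator {-1..1} y / 2) *\<^sub>R (indicator {-b..b} y * poly p y) \<partial>lborel)"
    by simp
  also have "\<dots> = (\<integral>y. (indicator {-b..b} y *\<^sub>R poly p y) / 2 \<partial>lborel)"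
    using assms by (intro Bochner_Integration.integral_cong refl) (auto simp: indicator_def)
  also have "\<dots> = (LINT y:{-b..b}|lborel. poly p y) / 2"
    by (simp add: set_lebesgue_integral_def)
  also have "\<dots> = integral {-b..b} (poly p) / 2"
    using set_borel_integral_eq_integral(2)[OF 1] by simp
  finally show ?thesis .
qed

text \<open>The singularity of the majorant is integrable: it is at most
  \<open>2 / sqrt (1 - y)\<close>, which has the antiderivative
  \<open>- 4 * sqrt (1 - y)\<close>.\<close>

lemma integral_tail_le:
  fixes p :: "real poly"
  assumes b: "0 \<le> b" "b \<le> 1"
    and p: "\<And>y. \<bar>y\<bar> < 1 \<Longrightarrow> \<bar>poly p y\<bar> \<le> 2 / sqrt (1 - y\<^sup>2)"
  shows "\<bar>integral {b..1} (poly p)\<bar> \<le> 4 * sqrt (1 - b)"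
proof -
  \<comment> \<open>At \<open>y = 1\<close> the quotient would be \<open>2 / 0 = 0\<close>, which
    need not dominate the polynomial, so the value there is set by hand.\<close>
  define g where "g = (\<lambda>y. if y = 1 then \<bar>poly p 1\<bar> else 2 / sqrt (1 - y))"
  have g: "(g has_integral (- 4 * sqrt (1 - 1)) - (- 4 * sqrt (1 - b))) {b..1}"
  proof (rule fundamental_theorem_of_calculus_interior[OF b(2)])
    show "continuous_on {b..1} (\<lambda>y. - 4 * sqrt (1 - y))"
      by (intro continuous_intros)
    fix y assume y: "y \<in> {b<..<1}"
    then have "((\<lambda>y. - 4 * sqrt (1 - y)) has_real_derivative g y) (at y)"
      by (auto intro!: derivative_eq_intros simp: g_def field_simps)
    then show "((\<lambda>y. - 4 * sqrt (1 - y)) has_vector_derivative g y) (at y)"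
      by (simp add: has_real_derivative_iff_has_vector_derivative)
  qed
  have "norm (integral {b..1} (poly p)) \<le> integral {b..1} g"
  proof (rule integral_norm_bound_integral)
    show "poly p integrable_on {b..1}"
      by (intro integrable_continuous_real continuous_intros)
    show "g integrable_on {b..1}" using g by blast
    fix y assume y: "y \<in> {b..1}"
    show "norm (poly p y) \<le> g y"
    proof (cases "y = 1")
      case False
      then have "y < 1" "\<bar>y\<bar> < 1" using y b by auto
      moreover have "2 / sqrt (1 - y\<^sup>2) \<le> 2 / sqrt (1 - y)"
        using y b \<open>y < 1\<close> by (intro divide_left_mono) (auto simp: power2_eq_square mult_left_le_one_le abs_square_less_1[of y, unfolded power2_eq_square])
      ultimately show ?thesis using p[of y] by (simp add: g_def)
    qed (simp add: g_def)
  qed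
  also have "integral {b..1} g = 4 * sqrt (1 - b)"
    using integral_unique[OF g] by simp
  finally show ?thesis by simp
qed

text \<open>The product is at most the mean of the two squares, and Bernstein's inequality bounds
  each square.\<close>

lemma abs_legendre_prod_le:
  assumes "\<bar>y\<bar> < 1"
  shows "\<bar>legendre j y * legendre k y\<bar> \<le> 2 / sqrt (1 - y\<^sup>2)"
proof -
  have pos: "sqrt (1 - y\<^sup>2) > 0" using assms by (simp add: abs_square_less_1)
  have sq: "(legendre n y)\<^sup>2 \<le> 2 / sqrt (1 - y\<^sup>2)" for n
    using legendre_bernstein[OF assms, of n] pos by (simp add: pos_le_divide_eq)
  have "0 \<le> (\<bar>legendre j y\<bar> - \<bar>legendre k y\<bar>)\<^sup>2" by simp
  then have "2 * \<bar>legendre j y * legendre k y\<bar> \<le> (legendre j y)\<^sup>2 + (legendre k y)\<^sup>2"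
    by (simp add: power2_diff abs_mult)
  with sq[of j] sq[of k] show ?thesis by linarith
qed

text \<open>Written as a polynomial, the product of two orthonormal Legendre functions falls under
  the integration lemmas for \<open>poly\<close>.\<close>

definition legendre_prod :: "nat \<Rightarrow> nat \<Rightarrow> real poly" where
  "legendre_prod j k = smult (sqrt (2 * real j + 1) * sqrt (2 * real k + 1)) (legendre_poly j * legendre_poly k)"

lemma poly_legendre_prod: "poly (legendre_prod j k) y = legendre j y * legendre k y"
  by (simp add: legendre_prod_def legendre_def mult_ac)

text \<open>Orthonormality gives the integral over \<open>[-1, 1]\<close>. Truncation removes two
  end pieces of size at most \<open>4 * sqrt (1 - b)\<close> each, and the density 1/2 halves their
  sum.\<close>

lemma truncated_mean:
  assumes b: "0 \<le> b" "b \<le> 1"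
  shows "\<bar>(\<integral>y. indicator {-b..b} y * (legendre j y * legendre k y) \<partial>unif) - of_bool (j = k)\<bar> \<le> 4 * sqrt (1 - b)"
proof -
  define p where "p = legendre_prod j k"
  \<comment> \<open>Reflection \<open>y\<close> to \<open>- y\<close> turns the piece at -1 into a
    piece at 1, so that one tail estimate serves both ends.\<close>
  define p' where "p' = pcompose p [:0, -1:]"
  have int: "poly p integrable_on {c..d}" for c d
    by (intro integrable_continuous_real continuous_intros)
  have p: "poly p y = legendre j y * legendre k y" for y
    by (simp add: p_def poly_legendre_prod)
  have p_le: "\<bar>poly p y\<bar> \<le> 2 / sqrt (1 - y\<^sup>2)" if "\<bar>y\<bar> < 1" for y
    unfolding p using that by (rule abs_legendre_prod_le)
  have "integral {-1..1} (poly p) = integral {-1..-b} (poly p) + integral {-b..b} (poly p) + integral {b..1} (poly p)"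
    using b Henstock_Kurzweil_Integration.integral_combine[of "-1" "-b" 1 "poly p"]
      Henstock_Kurzweil_Integration.integral_combine[of "-b" b 1 "poly p"] int by simp
  moreover have "integral {-1..1} (poly p) / 2 = of_bool (j = k)"
    using integral_unif_poly[of p] legendre_orthonormal[of j k] by (simp add: p of_bool_def)
  moreover have "\<bar>integral {b..1} (poly p)\<bar> \<le> 4 * sqrt (1 - b)"
    using b p_le by (rule integral_tail_le)
  moreover have "\<bar>integral {-1..-b} (poly p)\<bar> \<le> 4 * sqrt (1 - b)"
  proof -
    have "poly p' (- y) = poly p y" for y
      by (simp add: p'_def poly_pcompose)
    then have "integral {-1..-b} (poly p) = integral {b..1} (poly p')"
      using Henstock_Kurzweil_Integration.integral_reflect_real[of 1 b "poly p'"] by simp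
    moreover have "\<bar>poly p' y\<bar> \<le> 2 / sqrt (1 - y\<^sup>2)" if "\<bar>y\<bar> < 1" for y
      using p_le[of "- y"] that by (simp add: p'_def poly_pcompose)
    ultimately show ?thesis using integral_tail_le[OF b, of p'] by simp
  qed
  moreover have "(\<integral>y. indicator {-b..b} y * (legendre j y * legendre k y) \<partial>unif) = integral {-b..b} (poly p) / 2"
    using integral_unif_truncated_poly[OF b, of p] by (simp add: p)
  ultimately show ?thesis by linarith
qed

text \<open>The squared product is at most \<open>4 / (1 - y\<^sup>2)\<close>, whose integral over
  \<open>[-b, b]\<close> grows only logarithmically as \<open>b\<close> tends to 1, with no
  dependence on \<open>j\<close> and \<open>k\<close>.\<close>

lemma truncated_second_moment:
  assumes b: "0 \<le> b" "b < 1"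
  shows "(\<integral>y. (indicator {-b..b} y * (legendre j y * legendre k y))\<^sup>2 \<partial>unif) \<le> 2 * ln (2 / (1 - b))"
proof -
  define p where "p = (legendre_prod j k)\<^sup>2"
  have p: "poly p y = (legendre j y * legendre k y)\<^sup>2" for y
    by (simp add: p_def poly_legendre_prod)
  define F where "F = (\<lambda>y::real. 2 * (ln (1 + y) - ln (1 - y)))"
  have F: "((\<lambda>y. 4 / (1 - y\<^sup>2)) has_integral F b - F (- b)) {-b..b}"
  proof (rule fundamental_theorem_of_calculus)
    fix y assume "y \<in> {-b..b}"
    then have y: "1 + y > 0" "1 - y > 0" using b by auto
    have "(F has_real_derivative 4 / (1 - y\<^sup>2)) (at y)"
    proof -
      have "1 - y\<^sup>2 = (1 + y) * (1 - y)" by (simp add: power2_eq_square algebra_simps)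
      with y show ?thesis
        unfolding F_def by (auto intro!: derivative_eq_intros simp: field_simps)
    qed
    then show "(F has_vector_derivative 4 / (1 - y\<^sup>2)) (at y within {-b..b})"
      by (simp add: has_real_derivative_iff_has_vector_derivative has_vector_derivative_at_within)
  qed (use b in simp)
  have "(\<integral>y. (indicator {-b..b} y * (legendre j y * legendre k y))\<^sup>2 \<partial>unif)
      = (\<integral>y. indicator {-b..b} y * poly p y \<partial>unif)"
    by (intro Bochner_Integration.integral_cong refl) (simp add: p indicator_def)
  also have "\<dots> = integral {-b..b} (poly p) / 2"
    using b by (intro integral_unif_truncated_poly) auto
  also have "integral {-b..b} (poly p) \<le> F b - F (- b)"
  proof -
    have "(poly p has_integral integral {-b..b} (poly p)) {-b..b}"
      by (intro integrable_integral integrable_continuous_real continuous_intros)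
    then show ?thesis
    proof (rule has_integral_le[OF _ F])
      fix y assume "y \<in> {-b..b}"
      then have y: "\<bar>y\<bar> < 1" using b by auto
      then have "poly p y \<le> (2 / sqrt (1 - y\<^sup>2))\<^sup>2"
        unfolding p using power_mono[OF abs_legendre_prod_le[OF y, of j k], of 2] by simp
      also have "\<dots> = 4 / (1 - y\<^sup>2)"
        using y by (simp add: power_divide abs_square_le_1)
      finally show "poly p y \<le> 4 / (1 - y\<^sup>2)" .
    qed
  qed
  also have "(F b - F (- b)) / 2 = 2 * ln ((1 + b) / (1 - b))"
    using b by (simp add: F_def ln_div)
  also have "\<dots> \<le> 2 * ln (2 / (1 - b))"
    using b by (auto intro!: divide_right_mono)
  finally show ?thesis by simp
qed

lemma truncated_bound:
  assumes b: "0 \<le> b" "b < 1"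
  shows "\<bar>indicator {-b..b} y * (legendre j y * legendre k y)\<bar> \<le> 2 / sqrt (1 - b)"
proof (cases "y \<in> {-b..b}")
  case True
  then have y: "\<bar>y\<bar> \<le> b" by auto
  then have "y\<^sup>2 \<le> b\<^sup>2" using power_mono[OF y, of 2] by simp
  also have "b\<^sup>2 \<le> b" using b by (simp add: power2_eq_square mult_left_le)
  finally have "2 / sqrt (1 - y\<^sup>2) \<le> 2 / sqrt (1 - b)"
    using b by (intro divide_left_mono) auto
  moreover have "\<bar>legendre j y * legendre k y\<bar> \<le> 2 / sqrt (1 - y\<^sup>2)"
    using y b by (intro abs_legendre_prod_le) auto
  ultimately show ?thesis using True by simp
qed (use b in simp)

subsection \<open>Tail bound and measurability\<close>

lemma exp_le_quadratic:
  fixes x :: real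
  assumes "\<bar>x\<bar> \<le> 1"
  shows "exp x \<le> 1 + x + x\<^sup>2"
proof (cases "x \<ge> 0")
  case True
  then show ?thesis using assms by (intro exp_bound) auto
next
  case False
  define u where "u = - x"
  have u: "u > 0" using False by (simp add: u_def)
  \<comment> \<open>The product is \<open>1 + u^3\<close>; it turns \<open>1 + u \<le> exp u\<close>
    into an upper bound for \<open>exp (- u)\<close>.\<close>
  have "1 \<le> (1 + u) * (1 - u + u\<^sup>2)"
    using u by (simp add: algebra_simps power2_eq_square)
  also have "\<dots> \<le> exp u * (1 - u + u\<^sup>2)"
  proof (rule mult_right_mono)
    show "1 + u \<le> exp u" by (rule exp_ge_add_one_self)
    show "0 \<le> 1 - u + u\<^sup>2" using assms by (simp add: u_def)
  qed
  finally have "exp (- u) \<le> 1 - u + u\<^sup>2"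
    by (simp add: exp_minus inverse_eq_divide divide_le_eq mult.commute)
  then show ?thesis by (simp add: u_def)
qed

text \<open>Chernoff's method with the quadratic bound on \<open>exp\<close>. The condition
  \<open>t * B \<le> 2 * V\<close> keeps \<open>l * X\<close> in \<open>[-1, 1]\<close>, where that
  bound holds; \<open>V\<close> bounds the uncentred second moment.\<close>

lemma bernstein_upper_tail:
  fixes X :: "'a \<Rightarrow> real"
  assumes "prob_space M" and X [measurable]: "X \<in> borel_measurable M"
    and bnd: "\<And>x. x \<in> space M \<Longrightarrow> \<bar>X x\<bar> \<le> B"
    and V: "(\<integral>x. (X x)\<^sup>2 \<partial>M) \<le> V" "V > 0" and t: "0 \<le> t" "t * B \<le> 2 * V" and I: "finite I"
  shows "measure (PiM I (\<lambda>_. M)) {y \<in> space (PiM I (\<lambda>_. M)).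
           (\<Sum>i\<in>I. X (y i)) \<ge> real (card I) * ((\<integral>x. X x \<partial>M) + t)}
       \<le> exp (- (real (card I) * t\<^sup>2 / (4 * V)))"
proof -
  interpret M: prob_space M by fact
  interpret P: product_prob_space "\<lambda>_. M" I by standard
  define \<mu> where "\<mu> = (\<integral>x. X x \<partial>M)"
  \<comment> \<open>This \<open>l\<close> minimizes the exponent
    \<open>l\<^sup>2 * V - l * t\<close> contributed by each sample, with minimum
    \<open>- t\<^sup>2 / (4 * V)\<close>.\<close>
  define l where "l = t / (2 * V)"
  define P where "P = PiM I (\<lambda>_. M)"
  define n where "n = real (card I)"
  have l: "l \<ge> 0" using t V by (simp add: l_def)
  have "l * B \<le> 1" using t V by (simp add: l_def divide_le_eq)
  have intX: "integrable M X"
    by (rule M.integrable_const_bound[where B = B]) (use bnd in auto)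
  have intX2: "integrable M (\<lambda>x. (X x)\<^sup>2)"
    by (rule M.integrable_const_bound[where B = "B\<^sup>2"])
       (use bnd in \<open>auto simp: abs_le_square_iff[symmetric] intro!: AE_I2 intro: order_trans[OF _ abs_ge_self]\<close>)
  have lX: "\<bar>l * X x\<bar> \<le> 1" if "x \<in> space M" for x
    using mult_left_mono[OF bnd[OF that] l] \<open>l * B \<le> 1\<close> l by (simp add: abs_mult)
  have intE: "integrable M (\<lambda>x. exp (l * (X x - \<mu>)))"
  proof (rule M.integrable_const_bound[where B = "exp (1 - l * \<mu>)"])
    show "AE x in M. norm (exp (l * (X x - \<mu>))) \<le> exp (1 - l * \<mu>)"
      using lX by (intro AE_I2) (force simp: algebra_simps)
  qed measurable
  have mgf: "(\<integral>x. exp (l * (X x - \<mu>)) \<partial>M) \<le> exp (l\<^sup>2 * V)"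
  proof -
    have "(\<integral>x. exp (l * (X x - \<mu>)) \<partial>M) \<le> (\<integral>x. exp (- (l * \<mu>)) * (1 + l * X x + l\<^sup>2 * (X x)\<^sup>2) \<partial>M)"
    proof (rule integral_mono[OF intE])
      show "integrable M (\<lambda>x. exp (- (l * \<mu>)) * (1 + l * X x + l\<^sup>2 * (X x)\<^sup>2))"
        using intX intX2 by simp
      show "exp (l * (X x - \<mu>)) \<le> exp (- (l * \<mu>)) * (1 + l * X x + l\<^sup>2 * (X x)\<^sup>2)" if "x \<in> space M" for x
      proof -
        have "exp (l * (X x - \<mu>)) = exp (- (l * \<mu>)) * exp (l * X x)"
          by (simp add: exp_add[symmetric] algebra_simps)
        then show ?thesis
          using exp_le_quadratic[OF lX[OF that]] by (simp add: power_mult_distrib)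
      qed
    qed
    also have "\<dots> = exp (- (l * \<mu>)) * (1 + l * \<mu> + l\<^sup>2 * (\<integral>x. (X x)\<^sup>2 \<partial>M))"
      using intX intX2 by (simp add: \<mu>_def M.prob_space)
    also have "\<dots> \<le> exp (- (l * \<mu>)) * exp (l * \<mu> + l\<^sup>2 * V)"
    proof (rule mult_left_mono)
      have "l\<^sup>2 * (\<integral>x. (X x)\<^sup>2 \<partial>M) \<le> l\<^sup>2 * V"
        by (intro mult_left_mono V(1)) auto
      then show "1 + l * \<mu> + l\<^sup>2 * (\<integral>x. (X x)\<^sup>2 \<partial>M) \<le> exp (l * \<mu> + l\<^sup>2 * V)"
        using exp_ge_add_one_self[of "l * \<mu> + l\<^sup>2 * V"] by linarith
    qed auto
    also have "\<dots> = exp (l\<^sup>2 * V)"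
      by (simp add: exp_add[symmetric])
    finally show ?thesis .
  qed
  define f where "f = (\<lambda>y. \<Prod>i\<in>I. exp (l * (X (y i) - \<mu>)))"
  have f_eq: "f y = exp (l * ((\<Sum>i\<in>I. X (y i)) - n * \<mu>))" for y
    by (simp add: f_def exp_sum[OF I, symmetric] sum_distrib_left[symmetric] sum_subtractf n_def)
  have intf: "integrable P f"
    unfolding f_def P_def using I intE by (intro P.product_integrable_prod) auto
  have "measure P {y \<in> space P. (\<Sum>i\<in>I. X (y i)) \<ge> n * (\<mu> + t)}
      \<le> measure P {y \<in> space P. f y \<ge> exp (l * (n * t))}"
  proof (rule finite_measure.finite_measure_mono)
    show "finite_measure P" unfolding P_def by (intro prob_space.finite_measure prob_space_PiM M.prob_space_axioms)
    show "{y \<in> space P. n * (\<mu> + t) \<le> (\<Sum>i\<in>I. X (y i))} \<subseteq> {y \<in> space P. exp (l * (n * t)) \<le> f y}"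
    proof safe
      fix y assume "n * (\<mu> + t) \<le> (\<Sum>i\<in>I. X (y i))"
      then have "n * t \<le> (\<Sum>i\<in>I. X (y i)) - n * \<mu>" by (simp add: algebra_simps)
      then show "exp (l * (n * t)) \<le> f y" using l by (simp add: f_eq mult_left_mono)
    qed
    show "{y \<in> space P. exp (l * (n * t)) \<le> f y} \<in> sets P"
      using borel_measurable_integrable[OF intf] by measurable
  qed
  also have "\<dots> \<le> (\<integral>y. f y \<partial>P) / exp (l * (n * t))"
    by (intro integral_Markov_inequality_measure[where A = "{}"] intf AE_I2) (simp_all add: f_eq)
  also have "(\<integral>y. f y \<partial>P) = (\<integral>x. exp (l * (X x - \<mu>)) \<partial>M) ^ card I"
    unfolding f_def P_def using I intE by (subst P.product_integral_prod) auto
  also have "\<dots> / exp (l * (n * t)) \<le> exp (l\<^sup>2 * V) ^ card I / exp (l * (n * t))"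
    using mgf by (intro divide_right_mono power_mono) auto
  also have "\<dots> = exp (- (n * t\<^sup>2 / (4 * V)))"
  proof -
    have "n * (l\<^sup>2 * V) - l * (n * t) = - (n * t\<^sup>2 / (4 * V))"
      using V by (simp add: l_def power2_eq_square field_simps)
    then show ?thesis
      by (simp add: exp_of_nat_mult[symmetric] exp_diff[symmetric] n_def)
  qed
  finally show ?thesis by (simp add: P_def \<mu>_def n_def)
qed

lemma bernstein_two_sided:
  fixes X :: "'a \<Rightarrow> real"
  assumes M: "prob_space M" and X [measurable]: "X \<in> borel_measurable M"
    and bnd: "\<And>x. x \<in> space M \<Longrightarrow> \<bar>X x\<bar> \<le> B"
    and V: "(\<integral>x. (X x)\<^sup>2 \<partial>M) \<le> V" "V > 0" and t: "0 \<le> t" "t * B \<le> 2 * V" and I: "finite I"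
  shows "measure (PiM I (\<lambda>_. M)) {y \<in> space (PiM I (\<lambda>_. M)).
           \<bar>(\<Sum>i\<in>I. X (y i)) - real (card I) * (\<integral>x. X x \<partial>M)\<bar> \<ge> real (card I) * t}
       \<le> 2 * exp (- (real (card I) * t\<^sup>2 / (4 * V)))"
proof -
  define P where "P = PiM I (\<lambda>_. M)"
  define n where "n = real (card I)"
  define A where "A = (\<lambda>X. {y \<in> space P. (\<Sum>i\<in>I. X (y i)) \<ge> n * ((\<integral>x. X x \<partial>M) + t)})"
  interpret P: prob_space P
    unfolding P_def by (intro prob_space_PiM M)
  have sets: "A Y \<in> sets P" if [measurable]: "Y \<in> borel_measurable M" for Y :: "'a \<Rightarrow> real"
    unfolding A_def P_def by measurable
  have "measure P {y \<in> space P. \<bar>(\<Sum>i\<in>I. X (y i)) - n * (\<integral>x. X x \<partial>M)\<bar> \<ge> n * t}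
      \<le> measure P (A X \<union> A (\<lambda>x. - X x))"
    by (intro P.finite_measure_mono sets.Un sets) (auto simp: A_def sum_negf algebra_simps)
  also have "\<dots> \<le> measure P (A X) + measure P (A (\<lambda>x. - X x))"
    by (intro measure_Un_le sets) auto
  also have "\<dots> \<le> exp (- (n * t\<^sup>2 / (4 * V))) + exp (- (n * t\<^sup>2 / (4 * V)))"
    unfolding A_def P_def n_def using assms by (intro add_mono bernstein_upper_tail[where B = B]) auto
  finally show ?thesis by (simp add: P_def n_def)
qed

text \<open>A quantifier over an uncountable set is reduced to countable ones. By compactness a
  positive continuous function stays above some \<open>1 / (n + 1)\<close>, and a non-strict bound
  of this kind passes from a countable dense subset to all of \<open>K\<close>.\<close>

lemma sets_Ball_compact_pos:
  fixes g :: "'a \<Rightarrow> 'b :: {metric_space, second_countable_topology} \<Rightarrow> real"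
  assumes K: "compact K" and cont: "\<And>y. y \<in> space M \<Longrightarrow> continuous_on K (g y)"
    and meas: "\<And>z. z \<in> K \<Longrightarrow> (\<lambda>y. g y z) \<in> borel_measurable M"
  shows "{y \<in> space M. \<forall>z\<in>K. g y z > 0} \<in> sets M"
proof -
  obtain D where D: "countable D" "D \<subseteq> K" "K \<subseteq> closure D"
    using separable[of K] by metis
  have "(\<forall>z\<in>K. g y z > 0) \<longleftrightarrow> (\<exists>n::nat. \<forall>z\<in>D. g y z \<ge> 1 / real (Suc n))" if y: "y \<in> space M" for y
  proof
    assume pos: "\<forall>z\<in>K. g y z > 0"
    show "\<exists>n::nat. \<forall>z\<in>D. g y z \<ge> 1 / real (Suc n)"
    proof (cases "K = {}")
      case False
      then obtain z0 where z0: "z0 \<in> K" "\<forall>z\<in>K. g y z0 \<le> g y z"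
        using continuous_attains_inf[OF K _ cont[OF y]] by blast
      then obtain n where "1 / real (Suc n) < g y z0"
        using pos nat_approx_posE by blast
      then have "\<forall>z\<in>D. g y z \<ge> 1 / real (Suc n)"
        using z0 D(2) by (meson less_eq_real_def order_trans subsetD)
      then show ?thesis by blast
    qed (use D in auto)
  next
    assume "\<exists>n::nat. \<forall>z\<in>D. g y z \<ge> 1 / real (Suc n)"
    then obtain n :: nat where n: "\<forall>z\<in>D. g y z \<ge> 1 / real (Suc n)" by blast
    show "\<forall>z\<in>K. g y z > 0"
    proof
      fix z assume "z \<in> K"
      then have "g y z \<ge> 1 / real (Suc n)"
      proof -
        obtain x where x: "\<And>i. x i \<in> D" "x \<longlonglongrightarrow> z"
          using D(3) \<open>z \<in> K\<close> closure_sequential by blast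
        have "(\<lambda>i. g y (x i)) \<longlonglongrightarrow> g y z"
          using cont[OF y] x D(2) \<open>z \<in> K\<close>
          by (intro continuous_on_tendsto_compose[OF cont[OF y]]) (auto intro!: always_eventually)
        then show ?thesis
          by (rule LIMSEQ_le_const) (use n x in auto)
      qed
      moreover have "1 / real (Suc n) > 0" by simp
      ultimately show "g y z > 0" by linarith
    qed
  qed
  then have "{y \<in> space M. \<forall>z\<in>K. g y z > 0}
      = {y \<in> space M. \<exists>n::nat. \<forall>z\<in>D. g y z \<ge> 1 / real (Suc n)}"
    by blast
  also have "\<dots> \<in> sets M"
  proof -
    have "{y \<in> space M. \<forall>z\<in>D. g y z \<ge> 1 / real (Suc n)} \<in> sets M" for n :: nat
    proof (rule sets.sets_Collect_countable_All'[OF _ D(1)])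
      fix z assume "z \<in> D"
      then have [measurable]: "(\<lambda>y. g y z) \<in> borel_measurable M" using meas D(2) by blast
      show "{y \<in> space M. 1 / real (Suc n) \<le> g y z} \<in> sets M" by measurable
    qed
    then show ?thesis by measurable
  qed
  finally show ?thesis .
qed

subsection \<open>Quadratic forms on the cone\<close>

text \<open>Cauchy-Schwarz bounds the part on \<open>S\<close> by \<open>sqrt s\<close> times its
  2-norm; the cone condition adds \<alpha> times as much for the rest.\<close>

lemma l1_cone_l1_le:
  assumes "finite J" "0 \<le> \<alpha>" "z \<in> l1_cone J s \<alpha>"
  shows "(\<Sum>j\<in>J. \<bar>z j\<bar>)\<^sup>2 \<le> (1 + \<alpha>)\<^sup>2 * real s * (L2_set z J)\<^sup>2"
proof -
  obtain S where S: "S \<subseteq> J" "card S = s"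
    and le: "(\<Sum>j\<in>J - S. \<bar>z j\<bar>) \<le> \<alpha> * sqrt (real s) * L2_set z S"
    using assms(3) by (auto simp: l1_cone_def l1_cone_on_def)
  have "(\<Sum>j\<in>S. \<bar>z j\<bar> * \<bar>1\<bar>) \<le> L2_set z S * L2_set (\<lambda>_. 1) S"
    by (rule L2_set_mult_ineq)
  also have "L2_set (\<lambda>_. 1) S = sqrt (real s)"
    by (simp add: L2_set_def S(2))
  finally have "(\<Sum>j\<in>S. \<bar>z j\<bar>) \<le> sqrt (real s) * L2_set z S"
    by (simp add: mult.commute)
  with le have "(\<Sum>j\<in>J. \<bar>z j\<bar>) \<le> (1 + \<alpha>) * sqrt (real s) * L2_set z S"
    using sum.subset_diff[OF S(1) assms(1), of "\<lambda>j. \<bar>z j\<bar>"] by (simp add: algebra_simps)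
  also have "L2_set z S \<le> L2_set z J"
    unfolding L2_set_def using assms(1) S(1) by (intro real_sqrt_le_mono sum_mono2) auto
  then have "(1 + \<alpha>) * sqrt (real s) * L2_set z S \<le> (1 + \<alpha>) * sqrt (real s) * L2_set z J"
    using assms(2) by (intro mult_left_mono) auto
  finally have "(\<Sum>j\<in>J. \<bar>z j\<bar>)\<^sup>2 \<le> ((1 + \<alpha>) * sqrt (real s) * L2_set z J)\<^sup>2"
    by (intro power_mono sum_nonneg) auto
  then show ?thesis by (simp add: power_mult_distrib)
qed

section \<open>Homogeneity and measurability of the success event\<close>

lemma L2_set_power2: "(L2_set f A)\<^sup>2 = (\<Sum>i\<in>A. (f i)\<^sup>2)"
  by (simp add: L2_set_def sum_nonneg)

lemma L2_set_scale: "L2_set (\<lambda>j. c * z j) A = \<bar>c\<bar> * L2_set z A"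
  by (simp add: L2_set_def power_mult_distrib sum_distrib_left[symmetric] real_sqrt_mult)

lemma mat_vec_scale: "mat_vec J A (\<lambda>j. c * z j) = (\<lambda>i. c * mat_vec J A z i)"
  by (simp add: mat_vec_def sum_distrib_left mult_ac fun_eq_iff)

lemma l1_cone_scale:
  assumes "z \<in> l1_cone J s \<alpha>"
  shows "(\<lambda>j. c * z j) \<in> l1_cone J s \<alpha>"
proof -
  obtain S where S: "S \<subseteq> J" "card S = s" and z: "z \<in> vecs J"
    and le: "(\<Sum>j\<in>J - S. \<bar>z j\<bar>) \<le> \<alpha> * sqrt (real (card S)) * L2_set z S"
    using assms by (auto simp: l1_cone_def l1_cone_on_def)
  have "(\<Sum>j\<in>J - S. \<bar>c * z j\<bar>) \<le> \<alpha> * sqrt (real (card S)) * L2_set (\<lambda>j. c * z j) S"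
    using mult_left_mono[OF le, of "\<bar>c\<bar>"]
    by (simp add: L2_set_scale abs_mult sum_distrib_left[symmetric] mult_ac)
  with S z show ?thesis
    by (auto simp: l1_cone_def l1_cone_on_def vecs_def)
qed

text \<open>The topology is the product topology on \<open>nat \<Rightarrow> real\<close>.
  Normalized vectors that vanish outside \<open>J\<close> lie in a product of compact sets, and the
  cone is closed as a finite union of closed cones.\<close>

lemma compact_l1_cone_sphere:
  assumes "finite J"
  shows "compact {z \<in> l1_cone J s \<alpha>. L2_set z J = 1}"
proof -
  define B :: "(nat \<Rightarrow> real) set" where "B = PiE UNIV (\<lambda>j. if j \<in> J then {-1..1} else {0})"
  have cont: "continuous_on UNIV (\<lambda>z :: nat \<Rightarrow> real. z j)" for j
    by simp
  have contL2: "continuous_on UNIV (\<lambda>z :: nat \<Rightarrow> real. L2_set z A)" for A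
    unfolding L2_set_def by (intro continuous_intros cont)
  have "compactin (product_topology (\<lambda>_. euclidean) UNIV) B"
    unfolding B_def compactin_PiE by (auto simp: compactin_euclidean_iff)
  then have B: "compact B"
    by (simp add: euclidean_product_topology)
  have closed: "closed (l1_cone_on J S \<alpha>)" for S
  proof -
    have "l1_cone_on J S \<alpha> = (\<Inter>j\<in>-J. {z. z j = 0}) \<inter>
        {z. (\<Sum>j\<in>J - S. \<bar>z j\<bar>) \<le> \<alpha> * sqrt (real (card S)) * L2_set z S}"
      by (auto simp: l1_cone_on_def vecs_def)
    moreover have "closed \<dots>"
      by (intro closed_Int closed_INT ballI closed_Collect_eq closed_Collect_le continuous_intros cont contL2)
    ultimately show ?thesis by simp
  qed
  have "closed (l1_cone J s \<alpha>)"
    unfolding l1_cone_def using assms closed by (intro closed_UN) auto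
  moreover have "closed {z :: nat \<Rightarrow> real. L2_set z J = 1}"
    by (intro closed_Collect_eq contL2 continuous_intros)
  ultimately have "closed (l1_cone J s \<alpha> \<inter> {z. L2_set z J = 1})"
    by (rule closed_Int)
  then have "compact (B \<inter> (l1_cone J s \<alpha> \<inter> {z. L2_set z J = 1}))"
    by (rule compact_Int_closed[OF B])
  moreover have "l1_cone J s \<alpha> \<inter> {z. L2_set z J = 1} \<subseteq> B"
  proof
    fix z assume z: "z \<in> l1_cone J s \<alpha> \<inter> {z. L2_set z J = 1}"
    have "\<bar>z j\<bar> \<le> 1" if "j \<in> J" for j
      using member_le_L2_set[OF assms that, of "\<lambda>j. \<bar>z j\<bar>"] z by (simp add: L2_set_def)
    moreover have "z j = 0" if "j \<notin> J" for j
      using z that by (auto simp: l1_cone_def l1_cone_on_def vecs_def)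
    ultimately show "z \<in> B" by (auto simp: B_def abs_le_iff)
  qed
  ultimately show ?thesis by (simp add: Int_absorb1 Collect_conj_eq)
qed

text \<open>Both sides of the inequality scale quadratically and the cone is invariant under
  scaling. This replaces the punctured cone by a compact set, as the measurability argument
  requires.\<close>

lemma restricted_lower_bound_iff_sphere:
  assumes "finite J"
  shows "(\<forall>z \<in> l1_cone J s \<alpha> - {\<lambda>_. 0}. (L2_set (mat_vec J A z) I)\<^sup>2 > c * (L2_set z J)\<^sup>2)
     \<longleftrightarrow> (\<forall>z \<in> {z \<in> l1_cone J s \<alpha>. L2_set z J = 1}. (L2_set (mat_vec J A z) I)\<^sup>2 - c > 0)"
    (is "?L \<longleftrightarrow> ?R")
proof
  assume ?L
  show ?R
  proof
    fix z assume z: "z \<in> {z \<in> l1_cone J s \<alpha>. L2_set z J = 1}"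
    then have "z \<noteq> (\<lambda>_. 0)" by (auto simp: L2_set_def)
    with \<open>?L\<close> z show "(L2_set (mat_vec J A z) I)\<^sup>2 - c > 0" by force
  qed
next
  assume R: ?R
  show ?L
  proof
    fix z assume z: "z \<in> l1_cone J s \<alpha> - {\<lambda>_. 0}"
    then have "z \<in> vecs J" "z \<noteq> (\<lambda>_. 0)" by (auto simp: l1_cone_def l1_cone_on_def)
    then have "\<exists>j\<in>J. z j \<noteq> 0" by (force simp: vecs_def)
    then have "L2_set z J \<noteq> 0" using assms by (simp add: L2_set_eq_0_iff)
    then have pos: "L2_set z J > 0" using L2_set_nonneg[of z J] by linarith
    define a where "a = inverse (L2_set z J)"
    have "(\<lambda>j. a * z j) \<in> {z \<in> l1_cone J s \<alpha>. L2_set z J = 1}"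
      using z pos by (simp add: l1_cone_scale L2_set_scale a_def)
    with R have "(L2_set (mat_vec J A (\<lambda>j. a * z j)) I)\<^sup>2 - c > 0" by blast
    then have "c < a\<^sup>2 * (L2_set (mat_vec J A z) I)\<^sup>2"
      by (simp add: mat_vec_scale L2_set_scale power_mult_distrib)
    then have "c * (L2_set z J)\<^sup>2 < (L2_set z J)\<^sup>2 * (a\<^sup>2 * (L2_set (mat_vec J A z) I)\<^sup>2)"
      using pos by (simp add: mult.commute)
    also have "\<dots> = (L2_set (mat_vec J A z) I)\<^sup>2"
      using pos by (simp add: a_def power_inverse)
    finally show "(L2_set (mat_vec J A z) I)\<^sup>2 > c * (L2_set z J)\<^sup>2" .
  qed
qed

lemma sets_restricted_lower_bound:
  assumes "finite J"
  shows "{y \<in> space (PiM {1..m} (\<lambda>_. unif)). \<forall>z \<in> l1_cone J s \<alpha> - {\<lambda>_. 0}.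
           (L2_set (mat_vec J (sampling_matrix m y) z) {1..m})\<^sup>2 > c * (L2_set z J)\<^sup>2}
     \<in> sets (PiM {1..m} (\<lambda>_. unif))"
  unfolding restricted_lower_bound_iff_sphere[OF assms]
proof (rule sets_Ball_compact_pos[OF compact_l1_cone_sphere[OF assms]])
  fix y :: "nat \<Rightarrow> real"
  have "continuous_on UNIV (\<lambda>z. (L2_set (mat_vec J (sampling_matrix m y) z) {1..m})\<^sup>2 - c)"
    unfolding L2_set_power2 mat_vec_def by (intro continuous_intros) simp
  then show "continuous_on {z \<in> l1_cone J s \<alpha>. L2_set z J = 1}
      (\<lambda>z. (L2_set (mat_vec J (sampling_matrix m y) z) {1..m})\<^sup>2 - c)"
    by (rule continuous_on_subset) simp
next
  fix z :: "nat \<Rightarrow> real"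
  have [measurable]: "(\<lambda>y. mat_vec J (sampling_matrix m y) z i) \<in> borel_measurable (PiM {1..m} (\<lambda>_. unif))"
    if "i \<in> {1..m}" for i
    using that unfolding mat_vec_def sampling_matrix_def by measurable
  show "(\<lambda>y. (L2_set (mat_vec J (sampling_matrix m y) z) {1..m})\<^sup>2 - c)
      \<in> borel_measurable (PiM {1..m} (\<lambda>_. unif))"
    unfolding L2_set_power2 by measurable
qed

text \<open>Discarding the samples outside \<open>G\<close> only lowers a sum of squares. The
  remaining quadratic form differs from the identity entrywise by at most \<tau>, which costs at
  most \<tau> times the squared 1-norm.\<close>

lemma L2_set_mat_vec_ge:
  assumes m: "1 \<le> m"
    and dev: "\<And>j k. j \<in> J \<Longrightarrow> k \<in> J \<Longrightarrow>
      \<bar>(\<Sum>i\<in>{1..m}. indicator G (y i) * (legendre j (y i) * legendre k (y i))) - real m * of_bool (j = k)\<bar> \<le> real m * \<tau>"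
  shows "(L2_set (mat_vec J (sampling_matrix m y) z) {1..m})\<^sup>2 \<ge> (L2_set z J)\<^sup>2 - \<tau> * (\<Sum>j\<in>J. \<bar>z j\<bar>)\<^sup>2"
proof (cases "finite J")
  case J: True
  define f where "f = (\<lambda>i. \<Sum>j\<in>J. legendre j (y i) * z j)"
  define H where "H = (\<lambda>j k. \<Sum>i\<in>{1..m}. indicator G (y i) * (legendre j (y i) * legendre k (y i)))"
  have m0: "real m > 0" using m by simp
  have "mat_vec J (sampling_matrix m y) z i = f i / sqrt (real m)" for i
    by (simp add: mat_vec_def sampling_matrix_def f_def sum_divide_distrib)
  then have "real m * (L2_set (mat_vec J (sampling_matrix m y) z) {1..m})\<^sup>2 = (\<Sum>i\<in>{1..m}. (f i)\<^sup>2)"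
    using m0 by (simp add: L2_set_power2 power_divide sum_divide_distrib[symmetric])
  also have "\<dots> \<ge> (\<Sum>i\<in>{1..m}. indicator G (y i) * (f i)\<^sup>2)"
    by (intro sum_mono) (simp add: indicator_def)
  also have "(\<Sum>i\<in>{1..m}. indicator G (y i) * (f i)\<^sup>2) = (\<Sum>j\<in>J. \<Sum>k\<in>J. z j * z k * H j k)"
  proof -
    have "(\<Sum>i\<in>{1..m}. indicator G (y i) * (f i)\<^sup>2)
        = (\<Sum>i\<in>{1..m}. \<Sum>j\<in>J. \<Sum>k\<in>J. z j * z k * (indicator G (y i) * (legendre j (y i) * legendre k (y i))))"
      by (simp add: f_def power2_eq_square sum_product sum_distrib_left mult_ac)
    also have "\<dots> = (\<Sum>j\<in>J. \<Sum>i\<in>{1..m}. \<Sum>k\<in>J. z j * z k * (indicator G (y i) * (legendre j (y i) * legendre k (y i))))"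
      by (rule sum.swap)
    also have "\<dots> = (\<Sum>j\<in>J. \<Sum>k\<in>J. \<Sum>i\<in>{1..m}. z j * z k * (indicator G (y i) * (legendre j (y i) * legendre k (y i))))"
      by (intro sum.cong refl sum.swap)
    finally show ?thesis unfolding H_def sum_distrib_left .
  qed
  also have "\<dots> \<ge> (\<Sum>j\<in>J. \<Sum>k\<in>J. z j * z k * (real m * of_bool (j = k)) - real m * \<tau> * (\<bar>z j\<bar> * \<bar>z k\<bar>))"
  proof (intro sum_mono)
    fix j k assume "j \<in> J" "k \<in> J"
    then have "\<bar>H j k - real m * of_bool (j = k)\<bar> \<le> real m * \<tau>"
      unfolding H_def by (rule dev)
    then have "\<bar>z j * z k * (H j k - real m * of_bool (j = k))\<bar> \<le> \<bar>z j * z k\<bar> * (real m * \<tau>)"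
      by (simp add: abs_mult mult_left_mono)
    then show "z j * z k * (real m * of_bool (j = k)) - real m * \<tau> * (\<bar>z j\<bar> * \<bar>z k\<bar>) \<le> z j * z k * H j k"
      by (simp add: abs_mult right_diff_distrib mult_ac)
  qed
  also have "(\<Sum>j\<in>J. \<Sum>k\<in>J. z j * z k * (real m * of_bool (j = k)) - real m * \<tau> * (\<bar>z j\<bar> * \<bar>z k\<bar>))
      = real m * ((L2_set z J)\<^sup>2 - \<tau> * (\<Sum>j\<in>J. \<bar>z j\<bar>)\<^sup>2)"
  proof -
    have "(\<Sum>j\<in>J. \<Sum>k\<in>J. z j * z k * (real m * of_bool (j = k))) = real m * (L2_set z J)\<^sup>2"
      unfolding L2_set_power2 sum_distrib_left using J
      by (intro sum.cong refl) (simp add: of_bool_def if_distrib power2_eq_square cong: if_cong)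
    moreover have "(\<Sum>j\<in>J. \<Sum>k\<in>J. real m * \<tau> * (\<bar>z j\<bar> * \<bar>z k\<bar>)) = real m * \<tau> * (\<Sum>j\<in>J. \<bar>z j\<bar>)\<^sup>2"
      by (simp only: power2_eq_square sum_product) (simp add: sum_distrib_left)
    ultimately show ?thesis by (simp add: sum_subtractf right_diff_distrib)
  qed
  finally show ?thesis using m0 by simp
\<comment> \<open>For infinite \<open>J\<close> all sums over \<open>J\<close> are 0 by convention,
  and the claim is that a square is nonnegative.\<close>
qed (simp add: L2_set_def)

subsection \<open>The sampling bound\<close>

text \<open>It suffices that \<open>E \<ge> 2 * l + ln (1 / \<gamma>0)\<close> with
  \<open>l = ln (2 * N)\<close>. As \<open>l \<ge> 2/3\<close>, the two terms are at most
  \<open>3 * l\<^sup>2 / \<gamma>0\<close> and \<open>9/4 * l\<^sup>2 / \<gamma>0\<close>, together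
  below the 6 in the hypothesis.\<close>

lemma pair_count_le:
  fixes N \<gamma>0 E :: real
  assumes N: "N \<ge> 1" and g: "0 < \<gamma>0" "\<gamma>0 < 1" and E: "E \<ge> 6 * (ln (2 * N))\<^sup>2 / \<gamma>0"
  shows "2 * N\<^sup>2 * exp (- E) \<le> \<gamma>0 / 2"
proof -
  define l where "l = ln (2 * N)"
  have "ln 2 \<le> l" unfolding l_def using N by simp
  then have l: "l \<ge> 2/3" using ln2_ge_two_thirds by linarith
  have l2: "2 * l \<le> 3 * l\<^sup>2" "1 \<le> 9/4 * l\<^sup>2"
    using mult_right_mono[OF l, of l] mult_mono[OF l l] l by (auto simp: power2_eq_square)
  have "3 * l\<^sup>2 \<le> 3 * l\<^sup>2 / \<gamma>0"
    using g by (simp add: le_divide_eq mult_left_le)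
  moreover have "ln (1 / \<gamma>0) \<le> 1 / \<gamma>0 - 1"
    using g by (intro ln_le_minus_one) auto
  moreover have "1 / \<gamma>0 \<le> (9/4 * l\<^sup>2) / \<gamma>0"
    using l2 g by (intro divide_right_mono) auto
  moreover have "6 * l\<^sup>2 / \<gamma>0 = 3 * l\<^sup>2 / \<gamma>0 + 9/4 * l\<^sup>2 / \<gamma>0 + 3/4 * l\<^sup>2 / \<gamma>0"
    by (simp add: field_simps)
  moreover have "3/4 * l\<^sup>2 / \<gamma>0 \<ge> 0" using g by simp
  ultimately have "2 * l + ln (1 / \<gamma>0) \<le> E"
    using E l2 unfolding l_def by linarith
  then have "exp (- E) \<le> exp (- (2 * l + ln (1 / \<gamma>0)))" by simp
  also have "\<dots> = \<gamma>0 / (2 * N)\<^sup>2"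
  proof -
    have "exp (2 * l + ln (1 / \<gamma>0)) = (exp l)\<^sup>2 * exp (ln (1 / \<gamma>0))"
      by (simp only: exp_add exp_double)
    also have "\<dots> = (2 * N)\<^sup>2 * (1 / \<gamma>0)"
      using N g by (simp add: l_def del: ln_divide_pos)
    finally show ?thesis by (simp only: exp_minus) simp
  qed
  finally have "2 * N\<^sup>2 * exp (- E) \<le> 2 * N\<^sup>2 * (\<gamma>0 / (2 * N)\<^sup>2)"
    by (intro mult_left_mono) auto
  also have "\<dots> = \<gamma>0 / 2" using N by (simp add: power_mult_distrib field_simps)
  finally show ?thesis .
qed

lemma ln_sparsity_bounds:
  fixes K \<delta> :: real
  assumes K: "K \<ge> 4" and d: "0 < \<delta>" "\<delta> < 1"
  defines "sad \<equiv> K / \<delta> powr (3/2)"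
  shows "1 \<le> ln sad" and "ln (2 / (\<delta> / (16 * K))\<^sup>2) \<le> 7 * ln sad"
proof -
  have sad: "sad \<ge> K / \<delta>"
  proof -
    have "\<delta> powr (3/2) \<le> \<delta> powr 1" using d by (intro powr_mono') auto
    then show ?thesis unfolding sad_def using d K by (intro divide_left_mono) auto
  qed
  moreover have "K / \<delta> \<ge> K" using d K by (simp add: le_divide_eq mult_left_le)
  ultimately have sad4: "sad \<ge> 4" using K by linarith
  have "exp 1 \<le> sad" using exp_le sad4 by linarith
  then show "1 \<le> ln sad" using sad4 by (subst ln_ge_iff) auto
  have "2 / (\<delta> / (16 * K))\<^sup>2 = 512 * (K / \<delta>)\<^sup>2"
    using K d by (simp add: power_divide power_mult_distrib field_simps)
  \<comment> \<open>The factor 512 is absorbed by \<open>sad ^ 5\<close>, since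
    \<open>sad \<ge> 4\<close> and \<open>4 ^ 5 = 1024\<close>.\<close>
  also have "\<dots> \<le> sad ^ 5 * sad\<^sup>2"
  proof (intro mult_mono power_mono sad)
    have "(4::real) ^ 5 \<le> sad ^ 5" using sad4 by (intro power_mono) auto
    then show "512 \<le> sad ^ 5" by simp
  qed (use K d sad4 in auto)
  also have "\<dots> = sad ^ 7" by (simp flip: power_add)
  finally have "ln (2 / (\<delta> / (16 * K))\<^sup>2) \<le> ln (sad ^ 7)"
    using K d by (intro ln_mono) auto
  then show "ln (2 / (\<delta> / (16 * K))\<^sup>2) \<le> 7 * ln sad"
    using sad4 by (simp add: ln_realpow)
qed

text \<open>With \<open>t = \<delta> / (2 * K)\<close> and \<open>V = 14 * L\<close>,
  \<open>t\<^sup>2 / (4 * V)\<close> equals \<open>\<delta>\<^sup>2 / (224 * K\<^sup>2 * L)\<close>,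
  and \<open>1344 = 6 * 224\<close> leaves the 6 that \<open>pair_count_le\<close> requires.\<close>

lemma sample_exponent_ge:
  fixes K \<delta> \<gamma>0 L l m :: real
  assumes K: "K > 0" and d: "0 < \<delta>" "\<delta> < 1" and g: "0 < \<gamma>0" and L: "L \<ge> 1"
    and m: "m \<ge> 1344 * K\<^sup>2 * (\<delta> powr (-12) * inverse \<gamma>0 * L\<^sup>2 * l\<^sup>2)"
  shows "m * (\<delta> / (2 * K))\<^sup>2 / (4 * (14 * L)) \<ge> 6 * l\<^sup>2 / \<gamma>0"
proof -
  have "\<delta> powr (-2) \<le> \<delta> powr (-12)" using d by (intro powr_mono') auto
  then have "1 / \<delta>\<^sup>2 \<le> \<delta> powr (-12)"
    using d by (simp add: powr_minus powr_numeral inverse_eq_divide)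
  then have "1344 * K\<^sup>2 * (1 / \<delta>\<^sup>2 * inverse \<gamma>0 * (L * 1) * l\<^sup>2) \<le> 1344 * K\<^sup>2 * (\<delta> powr (-12) * inverse \<gamma>0 * (L * L) * l\<^sup>2)"
    using g L by (intro mult_left_mono mult_right_mono mult_mono) auto
  also have "\<dots> \<le> m" using m by (simp add: power2_eq_square)
  finally have "1344 * K\<^sup>2 * (1 / \<delta>\<^sup>2 * inverse \<gamma>0 * (L * 1) * l\<^sup>2) * ((\<delta> / (2 * K))\<^sup>2 / (4 * (14 * L))) \<le> m * ((\<delta> / (2 * K))\<^sup>2 / (4 * (14 * L)))"
    using L by (intro mult_right_mono) auto
  moreover have "1344 * K\<^sup>2 * (1 / \<delta>\<^sup>2 * inverse \<gamma>0 * (L * 1) * l\<^sup>2) * ((\<delta> / (2 * K))\<^sup>2 / (4 * (14 * L))) = 6 * l\<^sup>2 / \<gamma>0"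
    using K d g L by (simp add: power_divide power_mult_distrib field_simps)
  ultimately show ?thesis by simp
qed

theorem theorem3p2:
  shows "\<exists>C::real. C > 0 \<and> (\<forall>(J::nat set) (\<alpha>::real) (s::nat) (\<delta>::real) (\<gamma>::real) (\<gamma>0::real) (m::nat).
    finite J \<longrightarrow> \<alpha> > 1 \<longrightarrow> 1 \<le> s \<longrightarrow> s \<le> card J \<longrightarrow>
    0 < \<delta> \<longrightarrow> \<delta> < 1 \<longrightarrow> 0 < \<gamma> \<longrightarrow> 0 < \<gamma>0 \<longrightarrow> \<gamma> + \<gamma>0 < 1 \<longrightarrow> 1 \<le> m \<longrightarrow>
    (let N = real (card J);
         sad = (1 + \<alpha>)\<^sup>2 * real s / \<delta> powr (3/2)
     in real m \<ge> C * (1 + \<alpha>) ^ 4 * (real s)\<^sup>2 *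
          Max {\<delta> powr (-12) * inverse \<gamma>0 * (ln sad)\<^sup>2 * (ln (2 * N))\<^sup>2,
               \<delta> powr (-15/2) * ln sad powr (3/2) * ln (2 * N),
               \<delta> powr (-4) * ln sad * ln (ln sad / (\<gamma> * \<delta>))}) \<longrightarrow>
    measure (PiM {1..m} (\<lambda>_. unif))
      {y \<in> space (PiM {1..m} (\<lambda>_. unif)).
         \<forall>z \<in> l1_cone J s \<alpha> - {\<lambda>_. 0}.
           (L2_set (mat_vec J (sampling_matrix m y) z) {1..m})\<^sup>2 > (1 - \<delta>) * (L2_set z J)\<^sup>2}
      > 1 - (\<gamma> + \<gamma>0))"
proof (intro exI[of _ 1344] conjI allI impI)
  fix J :: "nat set" and \<alpha> :: real and s :: nat and \<delta> \<gamma> \<gamma>0 :: real and m :: nat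
  assume J: "finite J" and \<alpha>: "\<alpha> > 1" and s: "1 \<le> s" "s \<le> card J" and \<delta>: "0 < \<delta>" "\<delta> < 1"
    and \<gamma>: "0 < \<gamma>" and \<gamma>0: "0 < \<gamma>0" and \<gamma>1: "\<gamma> + \<gamma>0 < 1" and m: "1 \<le> m"
    and m_ge: "let N = real (card J);
         sad = (1 + \<alpha>)\<^sup>2 * real s / \<delta> powr (3/2)
     in real m \<ge> 1344 * (1 + \<alpha>) ^ 4 * (real s)\<^sup>2 *
          Max {\<delta> powr (-12) * inverse \<gamma>0 * (ln sad)\<^sup>2 * (ln (2 * N))\<^sup>2,
               \<delta> powr (-15/2) * ln sad powr (3/2) * ln (2 * N),
               \<delta> powr (-4) * ln sad * ln (ln sad / (\<gamma> * \<delta>))}"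
  define K where "K = (1 + \<alpha>)\<^sup>2 * real s"
  define N where "N = real (card J)"
  define L where "L = ln (K / \<delta> powr (3/2))"
  \<comment> \<open>\<open>b\<close> is chosen such that the truncation bias \<open>4 * \<eta>\<close> and the fluctuation \<open>t\<close> of each entry of the
    Gram matrix, multiplied by \<open>\<parallel>z\<parallel>\<^sub>1\<^sup>2 \<le> K \<parallel>z\<parallel>\<^sub>2\<^sup>2\<close>, contribute \<open>\<delta>/4\<close> and \<open>\<delta>/2\<close>.\<close>
  define \<eta> where "\<eta> = \<delta> / (16 * K)"
  define b where "b = 1 - \<eta>\<^sup>2"
  \<comment> \<open>\<open>V\<close> dominates the truncated second moment
    \<open>2 * ln (2 / \<eta>\<^sup>2) \<le> 2 * (7 * L)\<close>; \<open>B\<close> below is the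
    supremum bound \<open>2 / sqrt (1 - b)\<close>.\<close>
  define V where "V = 14 * L"
  define t where "t = \<delta> / (2 * K)"
  define B where "B = 2 / \<eta>"
  define P where "P = PiM {1..m} (\<lambda>_. unif)"
  define E where "E = real m * t\<^sup>2 / (4 * V)"
  define X where "X = (\<lambda>j k y. indicator {-b..b} y * (legendre j y * legendre k y))"
  define Bad where "Bad = (\<lambda>j k. {y \<in> space P.
      \<bar>(\<Sum>i\<in>{1..m}. X j k (y i)) - real m * (\<integral>x. X j k x \<partial>unif)\<bar> \<ge> real m * t})"
  define Good where "Good = {y \<in> space P. \<forall>z \<in> l1_cone J s \<alpha> - {\<lambda>_. 0}.
           (L2_set (mat_vec J (sampling_matrix m y) z) {1..m})\<^sup>2 > (1 - \<delta>) * (L2_set z J)\<^sup>2}"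
  interpret P: prob_space P
    unfolding P_def by (intro prob_space_PiM prob_space_unif)
  have N: "N \<ge> 1" using s by (simp add: N_def)
  have "2\<^sup>2 * 1 \<le> K"
    unfolding K_def using \<alpha> s by (intro mult_mono power_mono) auto
  then have K: "K \<ge> 4" by simp
  have L: "L \<ge> 1" "ln (2 / \<eta>\<^sup>2) \<le> 7 * L"
    unfolding L_def \<eta>_def using ln_sparsity_bounds[OF K \<delta>] by auto
  have \<eta>: "0 < \<eta>" "\<eta> < 1" using K \<delta> by (auto simp: \<eta>_def divide_less_eq)
  then have b: "0 \<le> b" "b < 1" "sqrt (1 - b) = \<eta>"
    by (auto simp: b_def power_le_one)
  have E: "E \<ge> 6 * (ln (2 * N))\<^sup>2 / \<gamma>0"
    unfolding E_def t_def V_def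
  proof (rule sample_exponent_ge)
    let ?M = "{\<delta> powr (-12) * inverse \<gamma>0 * L\<^sup>2 * (ln (2 * N))\<^sup>2,
               \<delta> powr (-15/2) * L powr (3/2) * ln (2 * N),
               \<delta> powr (-4) * L * ln (L / (\<gamma> * \<delta>))}"
    have "1344 * K\<^sup>2 * (\<delta> powr (-12) * inverse \<gamma>0 * L\<^sup>2 * (ln (2 * N))\<^sup>2) \<le> 1344 * K\<^sup>2 * Max ?M"
      by (intro mult_left_mono Max_ge) auto
    also have "\<dots> \<le> real m"
      using m_ge by (simp add: Let_def K_def N_def L_def power_mult_distrib flip: power_mult)
    finally show "1344 * K\<^sup>2 * (\<delta> powr (-12) * inverse \<gamma>0 * L\<^sup>2 * (ln (2 * N))\<^sup>2) \<le> real m" .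
  qed (use K \<delta> \<gamma>0 L in auto)
  have meas: "X j k \<in> borel_measurable unif" for j k
    unfolding X_def by measurable
  have bad: "measure P (Bad j k) \<le> 2 * exp (- E)" for j k
  proof -
    have "(\<integral>y. (X j k y)\<^sup>2 \<partial>unif) \<le> V"
      using truncated_second_moment[OF b(1,2), of j k] L(2) by (simp add: X_def V_def b_def)
    \<comment> \<open>Here \<open>t * B = 16\<close>, while
      \<open>2 * V = 28 * L \<ge> 28\<close>.\<close>
    moreover have "t * B \<le> 2 * V"
      using K \<delta> L by (simp add: t_def B_def \<eta>_def V_def)
    moreover have "\<bar>X j k y\<bar> \<le> B" for y
      unfolding X_def B_def using truncated_bound[OF b(1,2), of y j k] b(3) by simp
    ultimately show ?thesis
      using bernstein_two_sided[OF prob_space_unif meas, of j k B V t "{1..m}"] L(1) \<delta> K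
      by (simp add: Bad_def P_def E_def V_def t_def)
  qed
  have setsBad: "Bad j k \<in> sets P" for j k
  proof -
    note meas[measurable]
    show ?thesis unfolding Bad_def P_def by measurable
  qed
  define U where "U = (\<Union>(j, k)\<in>J \<times> J. Bad j k)"
  have "measure P U \<le> (\<Sum>(j, k)\<in>J \<times> J. measure P (Bad j k))"
    unfolding U_def case_prod_beta using J setsBad by (intro P.finite_measure_subadditive_finite) auto
  also have "\<dots> \<le> (\<Sum>(j, k)\<in>J \<times> J. 2 * exp (- E))"
    using bad by (intro sum_mono) auto
  also have "\<dots> = 2 * N\<^sup>2 * exp (- E)"
    by (simp add: N_def card_cartesian_product power2_eq_square)
  also have "\<dots> \<le> \<gamma>0 / 2"
    using N \<gamma>0 \<gamma> \<gamma>1 E by (intro pair_count_le) auto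
  finally have U: "measure P U \<le> \<gamma>0 / 2" .
  have setsU: "U \<in> sets P"
    unfolding U_def using J setsBad by (intro sets.finite_UN) auto
  have "space P - U \<subseteq> Good"
  proof
    fix y assume y: "y \<in> space P - U"
    define \<tau> where "\<tau> = t + 4 * \<eta>"
    have dev: "\<bar>(\<Sum>i\<in>{1..m}. indicator {-b..b} (y i) * (legendre j (y i) * legendre k (y i)))
        - real m * of_bool (j = k)\<bar> \<le> real m * \<tau>" if "j \<in> J" "k \<in> J" for j k
    proof -
      have "y \<notin> Bad j k" using y that by (auto simp: U_def)
      then have "\<bar>(\<Sum>i\<in>{1..m}. X j k (y i)) - real m * (\<integral>x. X j k x \<partial>unif)\<bar> < real m * t"
        using y by (simp add: Bad_def)
      moreover have "\<bar>(\<integral>x. X j k x \<partial>unif) - of_bool (j = k)\<bar> \<le> 4 * \<eta>"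
        using truncated_mean[of b j k] b by (simp add: X_def)
      then have "\<bar>real m * (\<integral>x. X j k x \<partial>unif) - real m * of_bool (j = k)\<bar> \<le> real m * (4 * \<eta>)"
        by (simp add: abs_mult mult_left_mono flip: right_diff_distrib)
      ultimately show ?thesis unfolding X_def \<tau>_def distrib_left by linarith
    qed
    have "(L2_set (mat_vec J (sampling_matrix m y) z) {1..m})\<^sup>2 > (1 - \<delta>) * (L2_set z J)\<^sup>2"
      if z: "z \<in> l1_cone J s \<alpha> - {\<lambda>_. 0}" for z
    proof -
      have "z \<in> vecs J" "z \<noteq> (\<lambda>_. 0)" using z by (auto simp: l1_cone_def l1_cone_on_def)
      then have "\<exists>j\<in>J. z j \<noteq> 0" by (force simp: vecs_def)
      then have pos: "(L2_set z J)\<^sup>2 > 0" using J by (simp add: L2_set_eq_0_iff)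
      have "\<tau> * (\<Sum>j\<in>J. \<bar>z j\<bar>)\<^sup>2 \<le> \<tau> * (K * (L2_set z J)\<^sup>2)"
        unfolding K_def using l1_cone_l1_le[OF J _ DiffD1[OF z]] \<alpha> \<eta> K \<delta>
        by (intro mult_left_mono) (auto simp: \<tau>_def t_def)
      also have "\<dots> = (3/4 * \<delta>) * (L2_set z J)\<^sup>2"
        using K by (simp add: \<tau>_def t_def \<eta>_def field_simps)
      also have "\<dots> < \<delta> * (L2_set z J)\<^sup>2"
        using pos \<delta> by simp
      finally have "\<tau> * (\<Sum>j\<in>J. \<bar>z j\<bar>)\<^sup>2 < \<delta> * (L2_set z J)\<^sup>2" .
      moreover have "(L2_set (mat_vec J (sampling_matrix m y) z) {1..m})\<^sup>2
          \<ge> (L2_set z J)\<^sup>2 - \<tau> * (\<Sum>j\<in>J. \<bar>z j\<bar>)\<^sup>2"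
        using m dev by (rule L2_set_mat_vec_ge)
      ultimately show ?thesis by (simp add: left_diff_distrib)
    qed
    then show "y \<in> Good" using y by (simp add: Good_def)
  qed
  \<comment> \<open>Monotonicity of \<open>measure\<close> needs this: a set outside the
    sigma-algebra would get measure 0 by default.\<close>
  moreover have "Good \<in> sets P"
    unfolding Good_def P_def by (rule sets_restricted_lower_bound[OF J])
  ultimately have "measure P (space P - U) \<le> measure P Good"
    by (rule P.finite_measure_mono)
  \<comment> \<open>The failure probability is at most \<open>\<gamma>0 / 2\<close>, so the final
    inequality is strict.\<close>
  then have "1 - \<gamma>0 / 2 \<le> measure P Good"
    using P.prob_compl[OF setsU] U by linarith
  then show "measure (PiM {1..m} (\<lambda>_. unif))
      {y \<in> space (PiM {1..m} (\<lambda>_. unif)).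
         \<forall>z \<in> l1_cone J s \<alpha> - {\<lambda>_. 0}.
           (L2_set (mat_vec J (sampling_matrix m y) z) {1..m})\<^sup>2 > (1 - \<delta>) * (L2_set z J)\<^sup>2}
      > 1 - (\<gamma> + \<gamma>0)"
    using \<gamma> \<gamma>0 unfolding Good_def P_def by linarith
qed simp

end
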